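(* Let $k$ be a field, let $n$ be a non-negative integer, and let $S = R = k[y_0,\dots,y_n]$ with the standard grading. Let $f_0,\dots,f_n \in R$ be an $R$-regular sequence of homogeneous elements of the same degree, and let $\varphi : S \to R$ be the $k$-algebra homomorphism given by $y_i \mapsto f_i$ for $0 \le i \le n$. For an ideal $J \subseteq S$, let $\varphi_*(J) \subseteq R$ denote the ideal of $R$ generated by $\varphi(J)$. Let $I \subseteq S$ be a saturated homogeneous ideal such that $V(I) \subseteq \mathbb{P}^n$ is a $0$-dimensional subscheme. Then for all positive integers $m$ and $r$, $$I^{(m)} \subseteq I^r \quad\text{if and only if}\quad (\varphi_*(I))^{(m)} \subseteq (\varphi_*(I))^r .$$
   Context: For an ideal $J$ in a commutative Noetherian domain $A$ with fraction field $A_{(0)}$, the $m$th symbolic power of $J$ is $$J^{(m)} = A \cap \bigcap_{P \in \mathrm{Ass}_A(J)} J^m A_P \subseteq A_{(0)},$$ where $\mathrm{Ass}_A(J)$ denotes the set of associated primes of $J$, i.e. of the $A$-module $A/J$. A homogeneous ideal $J \subseteq k[y_0,\dots,y_n]$ is saturated if $J : (y_0,\dots,y_n)^\infty = J$. $V(I) \subseteq \mathbb{P}^n$ is the closed subscheme $\mathrm{Proj}(S/I)$; it is not assumed to be reduced. *)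

theory Defs
  imports
    "HOL-Library.Poly_Mapping"
    "HOL-Library.Extended_Real"
    "HOL-Computational_Algebra.Fraction_Field"
    "HOL-Algebra.Ideal_Product"
    "HOL-Decision_Procs.Algebra_Aux"
    "HOL-Analysis.Abstract_Topology"
begin

section \<open>Ideals of a commutative ring given as a type\<close>

text \<open>
  A ring living on a whole type \<open>'a\<close> is turned into an \<open>HOL-Algebra\<close> structure by
  \<^const>\<open>cring_class_ops\<close>, so that ideals, generated ideals, prime ideals and products of ideals
  are those of the library. Powers of ideals are taken in the monoid of ideals
  \<^const>\<open>ideals_set\<close>; in particular the zeroth power is the unit ideal.
\<close>

abbreviation is_ideal :: "'a::comm_ring_1 set \<Rightarrow> bool" where
  "is_ideal J \<equiv> ideal J cring_class_ops"

abbreviation is_prime_ideal :: "'a::comm_ring_1 set \<Rightarrow> bool" where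
  "is_prime_ideal P \<equiv> primeideal P cring_class_ops"

abbreviation ideal_gen :: "'a::comm_ring_1 set \<Rightarrow> 'a set" where
  "ideal_gen G \<equiv> genideal cring_class_ops G"

abbreviation ideal_power :: "'a::comm_ring_1 set \<Rightarrow> nat \<Rightarrow> 'a set" where
  "ideal_power J m \<equiv> J [^]\<^bsub>ideals_set cring_class_ops\<^esub> m"

text \<open>
  Associated primes of the module \<open>A/J\<close>: the prime ideals that are the annihilator of the class
  of some \<open>x\<close>.
\<close>

definition associated_primes :: "'a::comm_ring_1 set \<Rightarrow> 'a set set" where
  "associated_primes J = {P. is_prime_ideal P \<and> (\<exists>x. P = {a. a * x \<in> J})}"

text \<open>
  For an ideal \<open>J\<close> and a prime ideal \<open>P\<close> of a domain \<open>A\<close>, the extension \<open>J A\<^sub>P\<close>, as a subset of the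
  fraction field. Since \<open>0 \<in> P\<close>, the denominators are nonzero.
\<close>

definition localized_ideal :: "'a::idom set \<Rightarrow> 'a set \<Rightarrow> 'a fract set" where
  "localized_ideal J P = {Fract a s |a s. a \<in> J \<and> s \<notin> P}"

text \<open>
  The preimage under \<open>A \<rightarrow> A\<^sub>(\<^sub>0\<^sub>)\<close> plays the role of the intersection with \<open>A\<close>.
\<close>

definition symbolic_power :: "'a::idom set \<Rightarrow> nat \<Rightarrow> 'a set" where
  "symbolic_power J m =
     (\<lambda>a. Fract a 1) -` (\<Inter>P\<in>associated_primes J. localized_ideal (ideal_power J m) P)"

text \<open>
  A regular sequence whose terms are indexed, in order, by a finite linearly ordered type.
\<close>

definition regular_sequence :: "('v::{finite,linorder} \<Rightarrow> 'a::comm_ring_1) \<Rightarrow> bool" where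
  "regular_sequence f \<longleftrightarrow>
     (\<forall>i g. g * f i \<in> ideal_gen (f ` {..<i}) \<longrightarrow> g \<in> ideal_gen (f ` {..<i})) \<and>
     ideal_gen (f ` UNIV) \<noteq> UNIV"

text \<open>\<open>J : K\<^sup>\<infinity>\<close>\<close>

definition ideal_saturation :: "'a::comm_ring_1 set \<Rightarrow> 'a set \<Rightarrow> 'a set" where
  "ideal_saturation J K = {p. \<exists>N. \<forall>q\<in>ideal_power K N. p * q \<in> J}"


section \<open>Polynomial rings with the standard grading\<close>

text \<open>
  Polynomials over \<open>'k\<close> in variables indexed by a finite type \<open>'v\<close>, as finitely supported functions
  on exponent vectors. The ring \<open>k[y\<^sub>0,\<dots>,y\<^sub>n]\<close> is obtained for \<open>'v\<close> with \<open>n + 1\<close> elements; finite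
  types are nonempty, so every instance is of this form with \<open>n \<ge> 0\<close>. The linear order on \<open>'v\<close> is
  the order \<open>0 < \<dots> < n\<close> of the indices.
\<close>

type_synonym ('v, 'k) mpoly = "('v \<Rightarrow>\<^sub>0 nat) \<Rightarrow>\<^sub>0 'k"

definition Const :: "'k \<Rightarrow> ('v, 'k::zero) mpoly" where
  "Const c = Poly_Mapping.single 0 c"

definition Var :: "'v \<Rightarrow> ('v, 'k::zero_neq_one) mpoly" where
  "Var i = Poly_Mapping.single (Poly_Mapping.single i 1) 1"

text \<open>The zero polynomial is homogeneous of every degree.\<close>

definition homogeneous :: "nat \<Rightarrow> ('v::finite, 'k::zero) mpoly \<Rightarrow> bool" where
  "homogeneous d p \<longleftrightarrow>
     (\<forall>t\<in>Poly_Mapping.keys p. (\<Sum>i\<in>UNIV. Poly_Mapping.lookup t i) = d)"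

definition homogeneous_ideal :: "('v::finite, 'k::comm_ring_1) mpoly set \<Rightarrow> bool" where
  "homogeneous_ideal J \<longleftrightarrow> (\<exists>G. (\<forall>g\<in>G. \<exists>d. homogeneous d g) \<and> J = ideal_gen G)"

definition irrelevant_ideal :: "('v::finite, 'k::comm_ring_1) mpoly set" where
  "irrelevant_ideal = ideal_gen (Var ` UNIV)"

definition saturated :: "('v::finite, 'k::comm_ring_1) mpoly set \<Rightarrow> bool" where
  "saturated J \<longleftrightarrow> ideal_saturation J irrelevant_ideal = J"

definition algebra_hom ::
    "(('v, 'k::comm_ring_1) mpoly \<Rightarrow> ('w, 'k) mpoly) \<Rightarrow> bool" where
  "algebra_hom \<phi> \<longleftrightarrow>
     \<phi> \<in> ring_hom cring_class_ops cring_class_ops \<and> (\<forall>c. \<phi> (Const c) = Const c)"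


section \<open>Projective space and dimension\<close>

text \<open>
  The points of \<open>Proj k[y\<^sub>0,\<dots>,y\<^sub>n]\<close>, with the Zariski topology: its basic open sets are
  \<open>D\<^sub>+(g)\<close> for homogeneous \<open>g\<close>.
\<close>

definition proj_points :: "('v::finite, 'k::field) mpoly set set" where
  "proj_points = {P. is_prime_ideal P \<and> homogeneous_ideal P \<and> \<not> irrelevant_ideal \<subseteq> P}"

definition zariski_topology :: "('v::finite, 'k::field) mpoly set topology" where
  "zariski_topology =
     topology_generated_by {{P \<in> proj_points. g \<notin> P} |g. \<exists>d. homogeneous d g}"

text \<open>
  The underlying space of the closed subscheme \<open>Proj (S/I)\<close>: homogeneous primes of \<open>S/I\<close>
  correspond to homogeneous primes of \<open>S\<close> containing \<open>I\<close>.
\<close>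

definition vanishing_space ::
    "('v::finite, 'k::field) mpoly set \<Rightarrow> ('v, 'k) mpoly set topology" where
  "vanishing_space I = subtopology zariski_topology {P \<in> proj_points. I \<subseteq> P}"

definition irreducible_closed :: "'a topology \<Rightarrow> 'a set \<Rightarrow> bool" where
  "irreducible_closed X C \<longleftrightarrow> closedin X C \<and> C \<noteq> {} \<and>
     (\<forall>A B. closedin X A \<and> closedin X B \<and> C = A \<union> B \<longrightarrow> C = A \<or> C = B)"

text \<open>
  Supremum of the lengths of strict chains of irreducible closed subsets; the empty space has
  dimension \<open>-\<infinity>\<close>.
\<close>

definition krull_dim :: "'a topology \<Rightarrow> ereal" where
  "krull_dim X = Sup {ereal (real l) |l.
     \<exists>C. (\<forall>i\<le>l. irreducible_closed X (C i)) \<and> (\<forall>i<l. C i \<subset> C (Suc i))}"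

end

theory Submission
  imports Defs
begin

text \<open>
  Let \<open>T(L)\<close> be the set of all \<open>a\<close> such that every variable has a power that multiplies \<open>a\<close> into \<open>L\<close>, that is,
  the saturation of \<open>L\<close> with respect to the irrelevant ideal. The proof rests on two facts.

  First, \<open>I\<^sup>(\<^sup>m\<^sup>) = T(I\<^sup>m)\<close> for a homogeneous ideal \<open>I\<close> of dimension zero for which the irrelevant ideal is not
  associated (\<open>symbolic_power_eq_saturation\<close>). An element of the saturation lies in every \<open>I\<^sup>m A\<^sub>P\<close>, because
  an associated prime \<open>P\<close> misses some variable. Conversely, let \<open>a \<in> I\<^sup>(\<^sup>m\<^sup>)\<close> and suppose that no power of
  some variable lies in \<open>I\<^sup>m : a\<close>. The radical of this colon ideal is homogeneous
  (\<open>graded_radical_colon\<close>) even though \<open>a\<close> need not be, so it is contained in a homogeneous prime \<open>Q\<close> that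
  misses the variable. As the ring is Noetherian, \<open>Q\<close> contains an associated prime of \<open>I\<close>, and dimension
  zero forces the two to agree. But \<open>a\<close> lies in the localization of \<open>I\<^sup>m\<close> at that prime, so \<open>I\<^sup>m : a\<close> cannot
  be contained in it.

  Second, \<open>\<phi>\<close> makes \<open>R\<close> a free \<open>S\<close>-module of finite rank (\<open>free_over_image\<close>). This is a dimension
  count. Regularity determines the Hilbert function of \<open>R/(f\<^sub>0,\<dots>,f\<^sub>n)\<close>: it is the same as for the sequence of
  the powers \<open>y\<^sub>i\<^sup>d\<close>, namely the number of monomials of each degree all of whose exponents are below \<open>d\<close>.
  Lifting bases of the graded pieces of the quotient gives elements \<open>b\<^sub>\<beta>\<close> indexed by these monomials. The
  products \<open>\<phi>(y\<^sup>\<alpha>) b\<^sub>\<beta>\<close> span \<open>R\<close> by induction on the degree, and there are only as many of them in each degree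
  as there are monomials \<open>y\<^bsup>d\<alpha>+\<beta>\<^esup>\<close>; hence they are linearly independent.

  In terms of coordinates with respect to \<open>b\<^sub>\<beta>\<close>, the ideal \<open>\<phi>\<^sub>*(L)\<close> consists of the elements all of whose
  coordinates lie in \<open>L\<close>. This gives \<open>\<phi>\<^sub>*(L) \<subseteq> \<phi>\<^sub>*(M)\<close> iff \<open>L \<subseteq> M\<close>, and also \<open>T(\<phi>\<^sub>*(L)) = \<phi>\<^sub>*(T(L))\<close>, because the
  irrelevant ideal and \<open>(f\<^sub>0,\<dots>,f\<^sub>n)\<close> have the same radical. Finally \<open>\<phi>\<^sub>*(I)\<close> satisfies the hypotheses of the
  first fact again; its dimension is zero because primes of a finite extension with the same
  contraction are incomparable. Therefore \<open>\<phi>\<^sub>*(I)\<^sup>(\<^sup>m\<^sup>) = \<phi>\<^sub>*(T(I\<^sup>m)) = \<phi>\<^sub>*(I\<^sup>(\<^sup>m\<^sup>))\<close> and \<open>\<phi>\<^sub>*(I)\<^sup>r = \<phi>\<^sub>*(I\<^sup>r)\<close>, so the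
  two containments are equivalent.
\<close>

section \<open>Ideals as submodules\<close>

text \<open>
  Ideals are the submodules of the ring over itself, which gives access to spans and their induction
  rules.
\<close>

interpretation rmod: module "(*) :: 'a::comm_ring_1 \<Rightarrow> 'a \<Rightarrow> 'a"
  by unfold_locales (simp_all add: algebra_simps)

(* Oriented against associativity, this rule would make rewriting with algebra_simps loop. *)
declare rmod.scale_scale [simp del]

lemma is_ideal_iff: "is_ideal J \<longleftrightarrow> rmod.subspace J"
proof
  assume J: "is_ideal J"
  then interpret ideal J cring_class_ops .
  show "rmod.subspace J"
  proof (rule rmod.subspaceI)
    show "0 \<in> J" using zero_closed by (simp add: zero_class)
    show "x + y \<in> J" if "x \<in> J" "y \<in> J" for x y
      using a_closed[OF that] by (simp add: plus_class)
    show "c * x \<in> J" if "x \<in> J" for c x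
      using I_l_closed[OF that, of c] by (simp add: class_simps)
  qed
next
  assume J: "rmod.subspace J"
  have neg: "inv\<^bsub>add_monoid cring_class_ops\<^esub> x \<in> J" if "x \<in> J" for x
    using rmod.subspace_neg[OF J that] uminus_class[of x] by (simp add: a_inv_def)
  show "is_ideal J"
  proof (rule idealI)
    show "Ring.ring (cring_class_ops :: 'a ring)"
      using cring_class by (rule cring.axioms)
    show "subgroup J (add_monoid (cring_class_ops :: 'a ring))"
      using J neg unfolding subgroup_def
      by (auto simp: class_simps rmod.subspace_add rmod.subspace_0 cring_class_ops_def)
  qed (use J rmod.subspace_scale[OF J] in \<open>auto simp: class_simps mult.commute\<close>)
qed

lemma ideal_gen_eq_span: "ideal_gen G = rmod.span G"
  unfolding genideal_def is_ideal_iff rmod.span_def hull_def by (simp add: conj_commute)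

lemma is_prime_ideal_iff:
  "is_prime_ideal P \<longleftrightarrow>
     rmod.subspace P \<and> 1 \<notin> P \<and> (\<forall>a b. a * b \<in> P \<longrightarrow> a \<in> P \<or> b \<in> P)"
proof
  assume P: "is_prime_ideal P"
  then have I: "is_ideal P" by (rule primeideal.axioms)
  then have S: "rmod.subspace P" by (simp add: is_ideal_iff)
  moreover have "1 \<notin> P"
  proof
    assume "1 \<in> P"
    then have "P = UNIV"
      using rmod.subspace_scale[OF S] by (metis UNIV_eq_I mult.right_neutral)
    then show False using primeideal.I_notcarr[OF P] by (simp add: cring_class_ops_def)
  qed
  ultimately show "rmod.subspace P \<and> 1 \<notin> P \<and> (\<forall>a b. a * b \<in> P \<longrightarrow> a \<in> P \<or> b \<in> P)"
    using primeideal.I_prime[OF P] by (simp add: class_simps)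
next
  assume P: "rmod.subspace P \<and> 1 \<notin> P \<and> (\<forall>a b. a * b \<in> P \<longrightarrow> a \<in> P \<or> b \<in> P)"
  then have "carrier cring_class_ops \<noteq> P" by (auto simp: cring_class_ops_def)
  with P show "is_prime_ideal P"
    by (intro primeidealI) (simp_all add: is_ideal_iff class_simps cring_class)
qed

(* Powers of ideals are handled through their description as spans of products. *)
declare nat_pow_0 [simp del] nat_pow_Suc [simp del]

lemma ideal_power_0: "ideal_power J 0 = UNIV"
  by (simp add: nat_pow_def ideals_set_def cring_class_ops_def)

lemma ideal_power_Suc: "ideal_power J (Suc m) = ideal_prod cring_class_ops (ideal_power J m) J"
  by (simp add: nat_pow_def ideals_set_def)

lemma ideal_prod_eq_span:
  assumes "rmod.subspace I" "rmod.subspace J"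
  shows "ideal_prod cring_class_ops I J = rmod.span {a * b |a b. a \<in> I \<and> b \<in> J}"
proof -
  have "I <#>\<^bsub>cring_class_ops\<^esub> J = {a * b |a b. a \<in> I \<and> b \<in> J}"
    by (auto simp: set_mult_def class_simps)
  then show ?thesis
    using ring.ideal_prod_eq_genideal[of cring_class_ops I J] assms cring.axioms(1)[OF cring_class]
    by (simp add: is_ideal_iff ideal_gen_eq_span)
qed

lemma subspace_ideal_power:
  assumes "rmod.subspace J"
  shows "rmod.subspace (ideal_power J m)"
  by (induction m) (simp_all add: ideal_power_0 ideal_power_Suc ideal_prod_eq_span assms)

lemma ideal_power_Suc_span:
  assumes "rmod.subspace J"
  shows "ideal_power J (Suc m) = rmod.span {a * b |a b. a \<in> ideal_power J m \<and> b \<in> J}"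
  by (simp add: ideal_power_Suc ideal_prod_eq_span subspace_ideal_power assms)

lemma power_mem_ideal_power: "rmod.subspace J \<Longrightarrow> x \<in> J \<Longrightarrow> x ^ m \<in> ideal_power J m"
  by (induction m) (auto simp: ideal_power_0 ideal_power_Suc_span power_commutes[symmetric]
      simp del: power_Suc simp: power_Suc2 intro!: rmod.span_base)

lemma ideal_power_one:
  assumes "rmod.subspace J" shows "ideal_power J (Suc 0) = J"
proof -
  have "{a * b |a b. a \<in> UNIV \<and> b \<in> J} = J"
  proof (intro equalityI subsetI)
    show "x \<in> {a * b |a b. a \<in> UNIV \<and> b \<in> J}" if "x \<in> J" for x
      using that by (intro CollectI exI[of _ 1] exI[of _ x]) simp
  qed (use rmod.subspace_scale[OF assms] in auto)
  then show ?thesis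
    using assms by (simp add: ideal_power_Suc_span ideal_power_0)
qed

lemma UNIV_eq_if_one_mem: "rmod.subspace J \<Longrightarrow> 1 \<in> J \<Longrightarrow> x \<in> J"
  using rmod.subspace_scale[of J 1 x] by simp

section \<open>Radicals and colon ideals\<close>

definition radical :: "'a::comm_ring_1 set \<Rightarrow> 'a set" where
  "radical K = {x. \<exists>n. x ^ n \<in> K}"

definition colon :: "'a::comm_ring_1 set \<Rightarrow> 'a \<Rightarrow> 'a set" where
  "colon J x = {a. a * x \<in> J}"

lemma subspace_colon:
  assumes J: "rmod.subspace J" shows "rmod.subspace (colon J x)"
proof (rule rmod.subspaceI)
  show "0 \<in> colon J x" using rmod.subspace_0[OF J] by (simp add: colon_def)
  show "a + b \<in> colon J x" if "a \<in> colon J x" "b \<in> colon J x" for a b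
    using that rmod.subspace_add[OF J, of "a * x" "b * x"] by (simp add: colon_def distrib_right)
  show "c * a \<in> colon J x" if "a \<in> colon J x" for c a
    using that rmod.subspace_scale[OF J, of "a * x" c] by (simp add: colon_def mult.assoc)
qed

lemma subspace_radical:
  fixes K :: "'a::comm_ring_1 set"
  assumes K: "rmod.subspace K"
  shows "rmod.subspace (radical K)"
proof (rule rmod.subspaceI)
  show "0 \<in> radical K"
    using rmod.subspace_0[OF K] unfolding radical_def by (intro CollectI exI[of _ 1]) simp
  show "c * x \<in> radical K" if "x \<in> radical K" for c x
  proof -
    from that obtain n where "x ^ n \<in> K" by (auto simp: radical_def)
    from rmod.subspace_scale[OF K this, of "c ^ n"] show ?thesis
      unfolding radical_def by (intro CollectI exI[of _ n]) (simp add: power_mult_distrib)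
  qed
next
  fix x y assume "x \<in> radical K" "y \<in> radical K"
  then obtain n m where nm: "x ^ n \<in> K" "y ^ m \<in> K" by (auto simp: radical_def)
  have "of_nat ((n + m) choose k) * x ^ k * y ^ (n + m - k) \<in> K" for k
  proof (cases "k \<ge> n")
    case True
    then have k: "x ^ k = x ^ (k - n) * x ^ n" by (simp flip: power_add)
    have "of_nat ((n + m) choose k) * x ^ k * y ^ (n + m - k)
        = (of_nat ((n + m) choose k) * x ^ (k - n) * y ^ (n + m - k)) * x ^ n"
      unfolding k by (simp only: ac_simps)
    then show ?thesis using rmod.subspace_scale[OF K nm(1)] by simp
  next
    case False
    then have k: "y ^ (n + m - k) = y ^ (n - k) * y ^ m" by (simp flip: power_add)
    have "of_nat ((n + m) choose k) * x ^ k * y ^ (n + m - k)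
        = (of_nat ((n + m) choose k) * x ^ k * y ^ (n - k)) * y ^ m"
      unfolding k by (simp only: ac_simps)
    then show ?thesis using rmod.subspace_scale[OF K nm(2)] by simp
  qed
  then have "(x + y) ^ (n + m) \<in> K"
    unfolding binomial_ring by (intro rmod.subspace_sum[OF K]) simp
  then show "x + y \<in> radical K" by (auto simp: radical_def)
qed

lemma subset_radical: "K \<subseteq> radical K"
  unfolding radical_def by (intro subsetI CollectI exI[of _ 1]) simp

lemma prime_power_mem:
  assumes "is_prime_ideal P" "x ^ n \<in> P" shows "x \<in> P"
  using assms(2)
proof (induction n)
  case 0
  then show ?case using assms(1) by (simp add: is_prime_ideal_iff)
next
  case (Suc n)
  then show ?case using assms(1) by (auto simp: is_prime_ideal_iff)
qed

lemma radical_subset_prime: "is_prime_ideal P \<Longrightarrow> K \<subseteq> P \<Longrightarrow> radical K \<subseteq> P"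
  by (auto simp: radical_def intro: prime_power_mem)

lemma radical_idem: "x ^ n \<in> radical K \<Longrightarrow> x \<in> radical K"
  by (auto simp: radical_def simp flip: power_mult)

section \<open>The standard grading\<close>

definition total_degree :: "('v::finite \<Rightarrow>\<^sub>0 nat) \<Rightarrow> nat" where
  "total_degree t = (\<Sum>i\<in>UNIV. Poly_Mapping.lookup t i)"

lemma total_degree_add [simp]: "total_degree (s + t) = total_degree s + total_degree t"
  by (simp add: total_degree_def lookup_add sum.distrib)

lemma total_degree_0 [simp]: "total_degree 0 = 0"
  by (simp add: total_degree_def)

lemma total_degree_single [simp]: "total_degree (Poly_Mapping.single i n) = n"
  by (simp add: total_degree_def lookup_single when_def)

lemma total_degree_eq_0_iff [simp]: "total_degree t = 0 \<longleftrightarrow> t = 0"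
  by (auto simp: total_degree_def poly_mapping_eq_iff fun_eq_iff)

definition degree_part :: "nat \<Rightarrow> ('v::finite, 'k::zero) mpoly \<Rightarrow> ('v, 'k) mpoly" where
  "degree_part e p = Abs_poly_mapping (\<lambda>t. Poly_Mapping.lookup p t when total_degree t = e)"

lemma lookup_degree_part: "Poly_Mapping.lookup (degree_part e p) t = (Poly_Mapping.lookup p t when total_degree t = e)"
proof -
  have "finite {t. (Poly_Mapping.lookup p t when total_degree t = e) \<noteq> 0}"
    by (rule finite_subset[OF _ finite_keys[of p]]) (auto simp: in_keys_iff)
  then show ?thesis by (simp add: degree_part_def)
qed

lemma degree_part_add: "degree_part e (p + q) = degree_part e p + degree_part e q"
  by (rule poly_mapping_eqI) (simp add: lookup_degree_part lookup_add when_def)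

lemma degree_part_0 [simp]: "degree_part e 0 = 0"
  by (rule poly_mapping_eqI) (simp add: lookup_degree_part)

lemma degree_part_diff: "degree_part e (p - q) = degree_part e p - degree_part e (q :: ('v::finite, 'k::ab_group_add) mpoly)"
  by (rule poly_mapping_eqI) (simp add: lookup_degree_part lookup_minus when_def)

lemma degree_part_sum: "degree_part e (\<Sum>x\<in>A. g x) = (\<Sum>x\<in>A. degree_part e (g x))"
  by (induction A rule: infinite_finite_induct) (simp_all add: degree_part_add)

lemma degree_part_single: "degree_part e (Poly_Mapping.single t c) = (if total_degree t = e then Poly_Mapping.single t c else 0)"
  by (rule poly_mapping_eqI) (auto simp: lookup_degree_part lookup_single when_def)

lemma degree_part_degree_part: "degree_part a (degree_part b p) = (if a = b then degree_part a p else 0)"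
  by (rule poly_mapping_eqI) (simp add: lookup_degree_part when_def)

lemma homogeneous_iff_degree_part: "homogeneous d p \<longleftrightarrow> degree_part d p = p"
  by (auto simp: homogeneous_def poly_mapping_eq_iff fun_eq_iff lookup_degree_part when_def in_keys_iff
      simp flip: total_degree_def)

lemma homogeneous_degree_part: "homogeneous d (degree_part d p)"
  by (simp add: homogeneous_iff_degree_part degree_part_degree_part)

lemma degree_part_of_homogeneous: "homogeneous d p \<Longrightarrow> degree_part e p = (if e = d then p else 0)"
  by (metis homogeneous_iff_degree_part degree_part_degree_part)

lemma mpoly_sum_single:
  fixes p :: "('v, 'k::comm_monoid_add) mpoly"
  shows "p = (\<Sum>t\<in>Poly_Mapping.keys p. Poly_Mapping.single t (Poly_Mapping.lookup p t))"
  by (rule poly_mapping_eqI) (auto simp: lookup_sum lookup_single when_def in_keys_iff)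

lemma mpoly_induct [case_names zero single add]:
  fixes p :: "('v, 'k::comm_monoid_add) mpoly"
  assumes "P 0" "\<And>t c. P (Poly_Mapping.single t c)" "\<And>p q. P p \<Longrightarrow> P q \<Longrightarrow> P (p + q)"
  shows "P p"
proof -
  have "finite A \<Longrightarrow> P (\<Sum>t\<in>A. Poly_Mapping.single t (Poly_Mapping.lookup p t))" for A
    by (induction A rule: finite_induct) (auto intro: assms)
  then show ?thesis by (subst mpoly_sum_single) simp
qed

lemma sum_degree_part:
  assumes "\<And>t. t \<in> Poly_Mapping.keys p \<Longrightarrow> total_degree t \<le> N"
  shows "(\<Sum>e\<le>N. degree_part e p) = p"
  using assms by (intro poly_mapping_eqI) (auto simp: lookup_sum lookup_degree_part when_def in_keys_iff)

lemma sum_degree_part_ex: "\<exists>N. \<forall>M\<ge>N. (\<Sum>e\<le>M. degree_part e p) = p"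
proof -
  have "finite (total_degree ` Poly_Mapping.keys p)" by simp
  then have "total_degree t \<le> Max (total_degree ` Poly_Mapping.keys p)" if "t \<in> Poly_Mapping.keys p" for t
    using that by simp
  then show ?thesis by (intro exI[of _ "Max (total_degree ` Poly_Mapping.keys p)"] allI impI sum_degree_part) (meson le_trans)
qed

lemma degree_part_mult:
  fixes p q :: "('v::finite, 'k::comm_semiring_1) mpoly"
  shows "degree_part n (p * q) = (\<Sum>a\<le>n. degree_part a p * degree_part (n - a) q)"
proof (induction p rule: mpoly_induct)
  case (single s c)
  show ?case
  proof (induction q rule: mpoly_induct)
    case (single t b)
    have "(\<Sum>a\<le>n. degree_part a (Poly_Mapping.single s c) * degree_part (n - a) (Poly_Mapping.single t b))
      = (\<Sum>a\<in>{..n}. if a = total_degree s then degree_part a (Poly_Mapping.single s c) * degree_part (n - a) (Poly_Mapping.single t b) else 0)"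
      by (intro sum.cong) (auto simp: degree_part_single)
    then show ?case
      by (auto simp: mult_single degree_part_single)
  qed (simp_all add: degree_part_add ring_distribs sum.distrib)
qed (simp_all add: degree_part_add ring_distribs sum.distrib)

lemma homogeneous_mult:
  fixes p q :: "('v::finite, 'k::comm_semiring_1) mpoly"
  assumes "homogeneous a p" "homogeneous b q"
  shows "homogeneous (a + b) (p * q)"
proof -
  have "degree_part (a + b) (p * q) = (\<Sum>i\<in>{..a + b}. if i = a then p * q else 0)"
    unfolding degree_part_mult using assms by (intro sum.cong) (auto simp: degree_part_of_homogeneous)
  then show ?thesis by (simp add: homogeneous_iff_degree_part)
qed

lemma degree_part_mult_homogeneous:
  fixes p q :: "('v::finite, 'k::comm_semiring_1) mpoly"
  assumes "homogeneous d q"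
  shows "degree_part n (p * q) = (if d \<le> n then degree_part (n - d) p * q else 0)"
proof -
  have "degree_part n (p * q) = (\<Sum>i\<in>{..n}. if i = n - d \<and> d \<le> n then degree_part (n - d) p * q else 0)"
    unfolding degree_part_mult using assms by (intro sum.cong) (auto simp: degree_part_of_homogeneous)
  then show ?thesis by auto
qed

definition graded :: "('v::finite, 'k::comm_ring_1) mpoly set \<Rightarrow> bool" where
  "graded J \<longleftrightarrow> (\<forall>p\<in>J. \<forall>e. degree_part e p \<in> J)"

text \<open>
  A product of two elements of graded ideals is in general not homogeneous. The criterion therefore asks
  only that the homogeneous components of each generator lie in the span; in this form it applies to
  powers and to extensions of ideals.
\<close>

lemma graded_span:
  fixes G :: "('v::finite, 'k::comm_ring_1) mpoly set"
  assumes "\<And>g e. g \<in> G \<Longrightarrow> degree_part e g \<in> rmod.span G"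
  shows "graded (rmod.span G)"
proof -
  have "\<forall>e. degree_part e p \<in> rmod.span G" if "p \<in> rmod.span G" for p
    using that
  proof (induction rule: rmod.span_induct_alt)
    case base
    then show ?case by (simp add: rmod.span_zero)
  next
    case (step c x y)
    have "degree_part e (c * x) \<in> rmod.span G" for e
      unfolding degree_part_mult using assms[OF \<open>x \<in> G\<close>] by (intro rmod.span_sum rmod.span_scale)
    then show ?case using step.IH by (simp add: degree_part_add rmod.span_add)
  qed
  then show ?thesis by (simp add: graded_def)
qed

lemma graded_span_homogeneous:
  fixes G :: "('v::finite, 'k::comm_ring_1) mpoly set"
  assumes "\<And>g. g \<in> G \<Longrightarrow> \<exists>d. homogeneous d g"
  shows "graded (rmod.span G)"
proof (rule graded_span)
  fix g e assume "g \<in> G"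
  with assms obtain d where "homogeneous d g" by blast
  then show "degree_part e g \<in> rmod.span G"
    using \<open>g \<in> G\<close> by (simp add: degree_part_of_homogeneous rmod.span_zero rmod.span_base)
qed

lemma graded_ideal_power:
  fixes J :: "('v::finite, 'k::comm_ring_1) mpoly set"
  assumes "rmod.subspace J" "graded J"
  shows "graded (ideal_power J m)"
proof (induction m)
  case 0
  show ?case by (simp add: ideal_power_0 graded_def)
next
  case (Suc m)
  show ?case unfolding ideal_power_Suc_span[OF assms(1)]
  proof (rule graded_span)
    fix g e assume "g \<in> {a * b |a b. a \<in> ideal_power J m \<and> b \<in> J}"
    then obtain a b where g: "g = a * b" "a \<in> ideal_power J m" "b \<in> J" by blast
    have "degree_part i a \<in> ideal_power J m" "degree_part i b \<in> J" for i
      using Suc assms(2) g by (auto simp: graded_def)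
    then show "degree_part e g \<in> rmod.span {a * b |a b. a \<in> ideal_power J m \<and> b \<in> J}"
      unfolding g degree_part_mult by (intro rmod.span_sum rmod.span_base) blast
  qed
qed

text \<open>
  The way membership in an ideal is deduced from membership of the homogeneous components.
\<close>

lemma mem_span_degree_parts: "p \<in> rmod.span (range (\<lambda>e. degree_part e (p :: ('v::finite, 'k::comm_ring_1) mpoly)))"
proof -
  obtain N where "\<forall>M\<ge>N. (\<Sum>e\<le>M. degree_part e p) = p" using sum_degree_part_ex[of p] ..
  then have N: "(\<Sum>e\<le>N. degree_part e p) = p" by (elim allE[of _ N] impE) auto
  have "(\<Sum>e\<le>N. degree_part e p) \<in> rmod.span (range (\<lambda>e. degree_part e p))"
    by (intro rmod.span_sum rmod.span_base) simp
  then show ?thesis by (simp only: N)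
qed

lemma homogeneous_ideal_iff:
  assumes "rmod.subspace J"
  shows "homogeneous_ideal J \<longleftrightarrow> graded J"
proof
  show "graded J" if "homogeneous_ideal J"
    using that by (auto simp: homogeneous_ideal_def ideal_gen_eq_span intro!: graded_span_homogeneous)
next
  assume g: "graded J"
  let ?G = "{degree_part e p |e p. p \<in> J}"
  have "J \<subseteq> rmod.span ?G"
  proof
    fix p assume "p \<in> J"
    then have "range (\<lambda>e. degree_part e p) \<subseteq> ?G" by auto
    from rmod.span_mono[OF this] show "p \<in> rmod.span ?G" using mem_span_degree_parts[of p] by (rule subsetD)
  qed
  moreover have "?G \<subseteq> J" using g by (auto simp: graded_def)
  ultimately have "J = rmod.span ?G"
    by (intro equalityI rmod.span_minimal assms)
  then show "homogeneous_ideal J"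
    unfolding homogeneous_ideal_def ideal_gen_eq_span
    by (intro exI[of _ ?G] conjI) (auto intro: homogeneous_degree_part)
qed

lemma graded_mem_iff: "rmod.subspace J \<Longrightarrow> graded J \<Longrightarrow> p \<in> J \<longleftrightarrow> (\<forall>e. degree_part e p \<in> J)"
  using mem_span_degree_parts[of p] rmod.span_minimal[of "range (\<lambda>e. degree_part e p)" J]
  by (auto simp only: graded_def subset_iff image_iff)

section \<open>Dickson's lemma and Hilbert's basis theorem\<close>

lemma nat_seq_mono_subseq:
  fixes s :: "nat \<Rightarrow> nat"
  shows "\<exists>r::nat \<Rightarrow> nat. strict_mono r \<and> mono (\<lambda>n. s (r n))"
proof -
  obtain f where f: "strict_mono f" "monoseq (\<lambda>n. s (f n))"
    using seq_monosub[of s] by blast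
  show ?thesis
  proof (cases "\<forall>m. \<forall>n\<ge>m. s (f m) \<le> s (f n)")
    case True
    then show ?thesis using f(1) by (intro exI[of _ f]) (simp add: mono_def)
  next
    case False
    with f(2) have dec: "\<forall>m. \<forall>n\<ge>m. s (f n) \<le> s (f m)" by (auto simp: monoseq_def)
    obtain N where N: "\<forall>n. s (f N) \<le> s (f n)"
      using ex_has_least_nat[of "\<lambda>_. True" 0 "\<lambda>n. s (f n)"] by auto
    have "s (f (N + n)) = s (f N)" for n
      using N dec by (simp add: antisym)
    moreover have "strict_mono (\<lambda>n. f (N + n))"
      using f(1) by (simp add: strict_mono_def)
    ultimately show ?thesis
      by (intro exI[of _ "\<lambda>n. f (N + n)"]) (simp add: mono_def)
  qed
qed

text \<open>
  Pass to a subsequence along which each of the finitely many coordinates is nondecreasing. The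
  conclusion states divisibility by exhibiting the quotient monomial \<open>w\<close>.
\<close>

lemma dickson:
  fixes u :: "nat \<Rightarrow> ('v::finite \<Rightarrow>\<^sub>0 nat)"
  shows "\<exists>i j w. i < j \<and> u j = w + u i"
proof -
  have "finite A \<Longrightarrow> \<exists>r::nat \<Rightarrow> nat. strict_mono r \<and> (\<forall>v\<in>A. mono (\<lambda>n. Poly_Mapping.lookup (u (r n)) v))"
    for A :: "'v set"
  proof (induction A rule: finite_induct)
    case empty
    show ?case by (auto intro: exI[of _ id] simp: strict_mono_def)
  next
    case (insert x A)
    then obtain r :: "nat \<Rightarrow> nat" where r: "strict_mono r" "\<forall>v\<in>A. mono (\<lambda>n. Poly_Mapping.lookup (u (r n)) v)"
      by blast
    obtain s :: "nat \<Rightarrow> nat" where s: "strict_mono s" "mono (\<lambda>n. Poly_Mapping.lookup (u (r (s n))) x)"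
      using nat_seq_mono_subseq[of "\<lambda>n. Poly_Mapping.lookup (u (r n)) x"] by blast
    have "mono (\<lambda>n. Poly_Mapping.lookup (u (r (s n))) v)" if "v \<in> A" for v
      using r(2) that strict_mono_mono[OF s(1)] by (simp add: mono_def)
    moreover have "strict_mono (\<lambda>n. r (s n))"
      using r(1) s(1) by (simp add: strict_mono_def)
    ultimately show ?case using s(2) by (intro exI[of _ "\<lambda>n. r (s n)"]) simp
  qed
  from this[OF finite_UNIV] obtain r :: "nat \<Rightarrow> nat" where r: "strict_mono r"
    "\<And>v. mono (\<lambda>n. Poly_Mapping.lookup (u (r n)) v)" by auto
  have le: "Poly_Mapping.lookup (u (r 0)) v \<le> Poly_Mapping.lookup (u (r 1)) v" for v
    using r(2)[of v] by (simp add: mono_def)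
  have "u (r 1) = (u (r 1) - u (r 0)) + u (r 0)"
    by (rule poly_mapping_eqI) (use le in \<open>simp add: lookup_add lookup_minus\<close>)
  moreover have "r 0 < r 1" using r(1) by (simp add: strict_mono_def)
  ultimately show ?thesis by blast
qed

lemma exponent_nonneg: "0 \<le> (w :: 'v::{finite,linorder} \<Rightarrow>\<^sub>0 nat)"
  by (rule leI) (simp add: less_poly_mapping.rep_eq less_fun_def)

text \<open>
  The lexicographic order extends divisibility of monomials, so an infinite descent would contradict
  Dickson's lemma.
\<close>

lemma wf_exponent_less: "wf {(s, t). s < (t :: 'v::{finite,linorder} \<Rightarrow>\<^sub>0 nat)}"
  unfolding wf_iff_no_infinite_down_chain
proof
  assume "\<exists>f. \<forall>i. (f (Suc i), f i) \<in> {(x, y). x < (y :: 'v \<Rightarrow>\<^sub>0 nat)}"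
  then obtain f :: "nat \<Rightarrow> 'v \<Rightarrow>\<^sub>0 nat" where "\<And>i. f (Suc i) < f i" by auto
  then have step: "\<And>i. f (Suc i) < f i" .
  have dec: "f j < f i" if "i < j" for i j
    using that
  proof (induction j)
    case (Suc j)
    then show ?case using step[of j] by (cases "i = j") (auto intro: less_trans)
  qed simp
  obtain i j w where "i < j" "f j = w + f i" using dickson[of f] by blast
  then show False using dec[of i j] add_right_mono[OF exponent_nonneg[of w], of "f i"] by simp
qed

definition lead_exp :: "('v::linorder, 'k::zero) mpoly \<Rightarrow> ('v \<Rightarrow>\<^sub>0 nat)" where
  "lead_exp p = Max (Poly_Mapping.keys p)"

lemma lookup_monomial_mult:
  fixes q :: "('v, 'k::comm_semiring_1) mpoly"
  shows "Poly_Mapping.lookup (Poly_Mapping.single w c * q) (w + t) = c * Poly_Mapping.lookup q t"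
proof (induction q rule: mpoly_induct)
  case (single s b)
  show ?case by (auto simp: mult_single lookup_single when_def)
qed (simp_all add: lookup_add distrib_left)

lemma keys_monomial_mult:
  "Poly_Mapping.keys (Poly_Mapping.single w c * (q :: ('v, 'k::comm_semiring_1) mpoly))
    \<subseteq> (+) w ` Poly_Mapping.keys q"
  using keys_mult[of "Poly_Mapping.single w c" q] by (auto split: if_splits)

lemma keys_le_lead_exp: "t \<in> Poly_Mapping.keys p \<Longrightarrow> t \<le> lead_exp p"
  by (simp add: lead_exp_def)

lemma lead_exp_in_keys: "p \<noteq> 0 \<Longrightarrow> lead_exp p \<in> Poly_Mapping.keys p"
  unfolding lead_exp_def by (intro Max_in) auto

text \<open>
  One step of polynomial division: the leading term of \<open>q\<close> is cancelled by a multiple of \<open>p\<close>.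
\<close>

lemma lead_exp_reduce:
  fixes p q :: "('v::{finite,linorder}, 'k::field) mpoly"
  assumes "p \<noteq> 0" "lead_exp q = w + lead_exp p" "q \<noteq> 0"
  obtains c where
    "q - Poly_Mapping.single w c * p = 0 \<or> lead_exp (q - Poly_Mapping.single w c * p) < lead_exp q"
proof
  define c where "c = Poly_Mapping.lookup q (lead_exp q) / Poly_Mapping.lookup p (lead_exp p)"
  let ?d = "q - Poly_Mapping.single w c * p"
  have "Poly_Mapping.lookup p (lead_exp p) \<noteq> 0"
    using lead_exp_in_keys[OF assms(1)] by (simp add: in_keys_iff)
  then have "Poly_Mapping.lookup ?d (lead_exp q) = 0"
    by (simp add: lookup_minus assms(2) lookup_monomial_mult) (simp add: c_def assms(2))
  then have ne: "lead_exp q \<notin> Poly_Mapping.keys ?d" by (simp add: in_keys_iff)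
  have "t \<le> lead_exp q" if "t \<in> Poly_Mapping.keys ?d" for t
  proof -
    have "t \<in> Poly_Mapping.keys q \<or> t \<in> Poly_Mapping.keys (Poly_Mapping.single w c * p)"
      using that by (auto simp: in_keys_iff lookup_minus)
    then show ?thesis
    proof
      assume "t \<in> Poly_Mapping.keys (Poly_Mapping.single w c * p)"
      then obtain s where "t = w + s" "s \<in> Poly_Mapping.keys p"
        using keys_monomial_mult[of w c p] by auto
      then show ?thesis using keys_le_lead_exp[of s p] by (simp add: assms(2) add_left_mono)
    qed (rule keys_le_lead_exp)
  qed
  then show "?d = 0 \<or> lead_exp ?d < lead_exp q"
    using lead_exp_in_keys[of ?d] ne by (metis order.not_eq_order_implies_strict)
qed

text \<open>
  Hilbert's basis theorem, proved directly for chains. From each difference \<open>L (Suc n) - L n\<close> take an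
  element with minimal leading monomial. By Dickson's lemma an earlier leading monomial divides a later
  one, and reducing the later element by the earlier one contradicts its minimality.
\<close>

lemma mpoly_ideal_chain_not_strict:
  fixes L :: "nat \<Rightarrow> ('v::{finite,linorder}, 'k::field) mpoly set"
  assumes sub: "\<And>n. rmod.subspace (L n)" and chain: "\<And>n. L n \<subset> L (Suc n)"
  shows False
proof -
  have mono: "L i \<subseteq> L j" if "i \<le> j" for i j
    by (rule lift_Suc_mono_le[of L, OF psubset_imp_subset[OF chain] that])
  have "\<exists>p. p \<in> L (Suc n) - L n \<and> (\<forall>q\<in>L (Suc n) - L n. \<not> lead_exp q < lead_exp p)" for n
  proof -
    obtain p where "p \<in> L (Suc n) - L n" using chain[of n] by auto
    then have "lead_exp p \<in> lead_exp ` (L (Suc n) - L n)" by (rule imageI)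
    from wfE_min[OF wf_exponent_less this] obtain t where "t \<in> lead_exp ` (L (Suc n) - L n)"
      "\<And>s. (s, t) \<in> {(s, t). s < t} \<Longrightarrow> s \<notin> lead_exp ` (L (Suc n) - L n)"
      by blast
    then show ?thesis by auto
  qed
  then have "\<exists>p. \<forall>n. p n \<in> L (Suc n) - L n \<and>
      (\<forall>q\<in>L (Suc n) - L n. \<not> lead_exp q < lead_exp (p n))"
    by (intro choice allI)
  then obtain p where p: "\<And>n. p n \<in> L (Suc n) - L n"
    and min: "\<And>n q. q \<in> L (Suc n) - L n \<Longrightarrow> \<not> lead_exp q < lead_exp (p n)"
    by blast
  have nz: "p n \<noteq> 0" for n
  proof
    assume "p n = 0"
    then show False using p[of n] rmod.subspace_0[OF sub[of n]] by simp
  qed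
  obtain i j w where ij: "i < j" and w: "lead_exp (p j) = w + lead_exp (p i)"
    using dickson[of "\<lambda>n. lead_exp (p n)"] by blast
  from lead_exp_reduce[OF nz w nz] obtain c where c:
    "p j - Poly_Mapping.single w c * p i = 0 \<or>
     lead_exp (p j - Poly_Mapping.single w c * p i) < lead_exp (p j)" .
  define q where "q = p j - Poly_Mapping.single w c * p i"
  have "p i \<in> L j" using p[of i] mono[of "Suc i" j] ij by auto
  then have m: "Poly_Mapping.single w c * p i \<in> L j" by (rule rmod.subspace_scale[OF sub])
  have "q \<notin> L j"
  proof
    assume "q \<in> L j"
    from rmod.subspace_add[OF sub this m] show False using p[of j] by (simp add: q_def)
  qed
  moreover have "q \<in> L (Suc j)"
    unfolding q_def using p[of j] m mono[of j "Suc j"] by (intro rmod.subspace_diff[OF sub]) auto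
  ultimately have "\<not> lead_exp q < lead_exp (p j)" by (intro min) simp
  moreover have "q \<noteq> 0" using \<open>q \<notin> L j\<close> rmod.subspace_0[OF sub[of j]] by blast
  ultimately show False using c by (simp add: q_def)
qed

lemma maximal_ideal_in_family:
  fixes A :: "('v::{finite,linorder}, 'k::field) mpoly set set"
  assumes sub: "\<And>J. J \<in> A \<Longrightarrow> rmod.subspace J" and ne: "A \<noteq> {}"
  obtains M where "M \<in> A" "\<And>J. J \<in> A \<Longrightarrow> M \<subseteq> J \<Longrightarrow> J = M"
proof (rule ccontr)
  assume "\<not> thesis"
  then have step: "\<exists>J\<in>A. M \<subset> J" if "M \<in> A" for M
    using that \<open>\<And>M. \<lbrakk>M \<in> A; \<And>J. \<lbrakk>J \<in> A; M \<subseteq> J\<rbrakk> \<Longrightarrow> J = M\<rbrakk> \<Longrightarrow> thesis\<close> by blast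
  have "\<exists>L. \<forall>n. L n \<in> A \<and> L n \<subset> L (Suc n)"
    using ne step by (intro dependent_nat_choice) auto
  then obtain L where "\<And>n. L n \<in> A" "\<And>n. L n \<subset> L (Suc n)" by blast
  with sub show False using mpoly_ideal_chain_not_strict[of L] by blast
qed

section \<open>Existence of primes in the Noetherian ring\<close>

text \<open>
  An ideal that is maximal among those containing \<open>H\<close> and no power of \<open>y\<close> is prime: if \<open>a\<close> and \<open>b\<close> are not
  in it, adjoining either one captures a power of \<open>y\<close>, and multiplying the two powers shows that \<open>a * b\<close>
  is not in it.
\<close>

lemma prime_ideal_avoiding:
  fixes H :: "('v::{finite,linorder}, 'k::field) mpoly set"
  assumes H: "rmod.subspace H" and y: "y \<notin> radical H"
  obtains Q where "is_prime_ideal Q" "H \<subseteq> Q" "y \<notin> Q"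
proof -
  define A where "A = {J. rmod.subspace J \<and> H \<subseteq> J \<and> y \<notin> radical J}"
  have "H \<in> A" using H y by (simp add: A_def)
  moreover have "rmod.subspace J" if "J \<in> A" for J using that by (simp add: A_def)
  ultimately obtain Q where Q: "Q \<in> A" and max: "\<And>J. J \<in> A \<Longrightarrow> Q \<subseteq> J \<Longrightarrow> J = Q"
    using maximal_ideal_in_family[of A] by blast
  have S: "rmod.subspace Q" and HQ: "H \<subseteq> Q" and yQ: "y \<notin> radical Q" using Q by (auto simp: A_def)
  have hit: "\<exists>n r. y ^ n - r * a \<in> Q" if "a \<notin> Q" for a
  proof -
    let ?J = "rmod.span (insert a Q)"
    have "Q \<subseteq> ?J" "a \<in> ?J" by (auto intro: rmod.span_base)
    then have "?J \<notin> A" using max that by blast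
    then have "y \<in> radical ?J" using HQ \<open>Q \<subseteq> ?J\<close> by (auto simp: A_def)
    then show ?thesis
      using S by (auto simp: radical_def rmod.span_insert rmod.span_eq_iff[THEN iffD2, OF S])
  qed
  have "a \<in> Q \<or> b \<in> Q" if ab: "a * b \<in> Q" for a b
  proof (rule ccontr)
    assume "\<not> (a \<in> Q \<or> b \<in> Q)"
    then obtain n r m s where 1: "y ^ n - r * a \<in> Q" and 2: "y ^ m - s * b \<in> Q"
      using hit by meson
    have "y ^ (n + m) = y ^ m * (y ^ n - r * a) + (r * a) * (y ^ m - s * b) + (r * s) * (a * b)"
      by (simp add: power_add algebra_simps)
    moreover have "y ^ m * (y ^ n - r * a) + (r * a) * (y ^ m - s * b) + (r * s) * (a * b) \<in> Q"
      by (rule rmod.subspace_add[OF S rmod.subspace_add[OF S]]; rule rmod.subspace_scale[OF S]; fact)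
    ultimately have "y ^ (n + m) \<in> Q" by (simp only:)
    then show False using yQ unfolding radical_def by blast
  qed
  moreover have "1 \<notin> Q"
  proof
    assume "1 \<in> Q"
    then have "y ^ 0 \<in> Q" by simp
    then show False using yQ unfolding radical_def by blast
  qed
  ultimately have "is_prime_ideal Q" using S by (simp add: is_prime_ideal_iff)
  moreover have "y \<notin> Q" using yQ subset_radical by blast
  ultimately show ?thesis using that HQ by blast
qed

text \<open>
  Choose an annihilator \<open>L : x\<close> maximal among those contained in \<open>Q\<close>. Replacing \<open>x\<close> by \<open>t * x\<close> with
  \<open>t \<notin> Q\<close> keeps the annihilator inside \<open>Q\<close>, hence does not change it. If \<open>a * b\<close> annihilates \<open>x\<close> but
  neither factor does, then \<open>L : a x\<close> is strictly larger, so it contains some \<open>t \<notin> Q\<close>; thus \<open>a\<close> annihilates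
  \<open>t * x\<close> and therefore \<open>x\<close>, a contradiction.
\<close>

lemma associated_prime_below:
  fixes L :: "('v::{finite,linorder}, 'k::field) mpoly set"
  assumes L: "rmod.subspace L" and Q: "is_prime_ideal Q" and LQ: "L \<subseteq> Q"
  obtains P where "P \<in> associated_primes L" "P \<subseteq> Q"
proof -
  define A where "A = {colon L x |x. colon L x \<subseteq> Q}"
  have Qp: "a \<in> Q \<or> b \<in> Q" if "a * b \<in> Q" for a b
    using Q that by (auto simp: is_prime_ideal_iff)
  have "colon L 1 = L" by (simp add: colon_def)
  then have "A \<noteq> {}" using LQ by (force simp: A_def)
  moreover have "rmod.subspace J" if "J \<in> A" for J
    using that subspace_colon[OF L] by (auto simp: A_def)
  ultimately obtain P where "P \<in> A" and max: "\<And>J. J \<in> A \<Longrightarrow> P \<subseteq> J \<Longrightarrow> J = P"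
    using maximal_ideal_in_family[of A] by blast
  then obtain x where x: "P = colon L x" and PQ: "P \<subseteq> Q" by (auto simp: A_def)
  have SP: "rmod.subspace P" by (simp add: x subspace_colon L)
  have stable: "colon L (t * x) = P" if "t \<notin> Q" for t
  proof (rule max)
    show "P \<subseteq> colon L (t * x)"
    proof
      fix a assume "a \<in> P"
      then show "a \<in> colon L (t * x)"
        using rmod.subspace_scale[OF L, of "a * x" t] by (simp add: x colon_def mult.left_commute)
    qed
    have "s \<in> Q" if "s \<in> colon L (t * x)" for s
    proof -
      have "s * t \<in> P" using that by (simp add: x colon_def mult.assoc)
      then show ?thesis using Qp[of s t] PQ \<open>t \<notin> Q\<close> by blast
    qed
    then show "colon L (t * x) \<in> A" by (auto simp: A_def)
  qed
  have "a \<in> P \<or> b \<in> P" if ab: "a * b \<in> P" for a b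
  proof (rule ccontr)
    assume neg: "\<not> (a \<in> P \<or> b \<in> P)"
    have bigger: "\<not> colon L (c * x) \<subseteq> Q" if "c \<notin> P" "d \<notin> P" "d * c \<in> P" for c d
    proof
      assume "colon L (c * x) \<subseteq> Q"
      then have "colon L (c * x) \<in> A" by (auto simp: A_def)
      moreover have "P \<subseteq> colon L (c * x)"
      proof
        fix e assume "e \<in> P"
        then show "e \<in> colon L (c * x)"
          using rmod.subspace_scale[OF L, of "e * x" c] by (simp add: x colon_def mult.left_commute)
      qed
      ultimately have "colon L (c * x) = P" by (rule max)
      moreover have "d \<in> colon L (c * x)" using that by (simp add: x colon_def mult.assoc)
      ultimately show False using that by simp
    qed
    have "\<not> colon L (a * x) \<subseteq> Q" using neg ab by (intro bigger[of a b]) (auto simp: mult.commute)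
    then obtain t where t: "t * (a * x) \<in> L" "t \<notin> Q" by (auto simp: colon_def)
    then have "a \<in> colon L (t * x)" by (simp add: colon_def mult.left_commute)
    then show False using stable[OF t(2)] neg by simp
  qed
  moreover have "1 \<notin> P" using PQ Q by (auto simp: is_prime_ideal_iff)
  ultimately have "is_prime_ideal P" using SP by (simp add: is_prime_ideal_iff)
  then have "P \<in> associated_primes L" using x by (auto simp: associated_primes_def colon_def)
  then show ?thesis using that PQ by blast
qed

section \<open>Homogeneous radicals and primes\<close>

lemma degree_part_eventually_zero:
  fixes p :: "('v::finite, 'k::zero) mpoly"
  shows "\<exists>N. \<forall>e>N. degree_part e p = 0"
proof -
  have "finite (total_degree ` Poly_Mapping.keys p)" by simp
  then obtain N where N: "\<forall>n\<in>total_degree ` Poly_Mapping.keys p. n \<le> N"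
    using finite_nat_set_iff_bounded_le by blast
  have "degree_part e p = 0" if "e > N" for e
  proof (rule poly_mapping_eqI)
    fix t
    show "Poly_Mapping.lookup (degree_part e p) t = Poly_Mapping.lookup 0 t"
    proof (cases "t \<in> Poly_Mapping.keys p")
      case True
      then have "total_degree t \<noteq> e" using N that by fastforce
      then show ?thesis by (simp add: lookup_degree_part)
    qed (simp add: lookup_degree_part in_keys_iff when_def)
  qed
  then show ?thesis by blast
qed

lemma degree_part_top_mult:
  fixes p q :: "('v::finite, 'k::comm_semiring_1) mpoly"
  assumes "\<forall>e>M. degree_part e p = 0" "\<forall>e>N. degree_part e q = 0"
  shows "degree_part (M + N) (p * q) = degree_part M p * degree_part N q"
    and "\<forall>e>M + N. degree_part e (p * q) = 0"
proof -
  have *: "degree_part a p * degree_part (n - a) q = 0" if "n \<ge> M + N" "a \<noteq> M \<or> n > M + N" for n a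
  proof (cases "a > M")
    case False
    then have "n - a > N" using that by auto
    then show ?thesis using assms(2) by simp
  qed (use assms(1) in simp)
  have "(\<Sum>a\<le>M + N. degree_part a p * degree_part (M + N - a) q)
      = (\<Sum>a\<in>{..M + N}. if a = M then degree_part M p * degree_part N q else 0)"
    using *[of "M + N"] by (intro sum.cong) auto
  then show "degree_part (M + N) (p * q) = degree_part M p * degree_part N q" by (simp add: degree_part_mult)
  show "\<forall>e>M + N. degree_part e (p * q) = 0"
    unfolding degree_part_mult using * by (auto intro!: sum.neutral)
qed

lemma degree_part_top_power:
  fixes p :: "('v::finite, 'k::comm_semiring_1) mpoly"
  assumes "\<forall>e>M. degree_part e p = 0"
  shows "degree_part (n * M) (p ^ n) = degree_part M p ^ n \<and> (\<forall>e>n * M. degree_part e (p ^ n) = 0)"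
proof (induction n)
  case 0
  have "homogeneous 0 (1 :: ('v, 'k) mpoly)" by (simp add: homogeneous_def)
  then show ?case by (simp add: degree_part_of_homogeneous)
next
  case (Suc n)
  then show ?case using degree_part_top_mult[OF assms, of "n * M" "p ^ n"] by simp
qed

text \<open>
  Let \<open>\<tau>\<close> be the top component of \<open>t\<close>. The top component of \<open>t * a\<close> is the product of the two top components, so \<open>\<tau>\<close>
  kills the top component of \<open>a\<close> modulo \<open>L\<close>. What remains of \<open>a\<close> has smaller degree and is multiplied into
  \<open>L\<close> by \<open>\<tau> * t\<close>, whose top component is \<open>\<tau>\<^sup>2\<close>. This is why the induction is on the degree bound \<open>D\<close> of \<open>a\<close>
  with \<open>t\<close> arbitrary.
\<close>

lemma top_part_annihilates:
  fixes L :: "('v::finite, 'k::comm_ring_1) mpoly set"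
  assumes L: "rmod.subspace L" "graded L"
    and "t * a \<in> L" "\<forall>e>M. degree_part e t = 0" "\<forall>e\<ge>D. degree_part e a = 0"
  shows "\<exists>k. degree_part M t ^ k * a \<in> L"
  using assms(3-)
proof (induction D arbitrary: a t M)
  case 0
  then have "a = 0" using mem_span_degree_parts[of a] by (simp add: rmod.span_singleton image_constant_conv)
  then show ?case using rmod.subspace_0[OF L(1)] by simp
next
  case (Suc D)
  define \<tau> b where "\<tau> = degree_part M t" and "b = a - degree_part D a"
  have \<tau>: "homogeneous M \<tau>" by (simp add: \<tau>_def homogeneous_degree_part)
  have "degree_part (M + D) (t * a) = \<tau> * degree_part D a"
    unfolding \<tau>_def using Suc.prems by (intro degree_part_top_mult) auto
  then have top: "\<tau> * degree_part D a \<in> L" using Suc.prems(1) L(2) by (metis graded_def)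
  have "(\<tau> * t) * b = \<tau> * (t * a) - t * (\<tau> * degree_part D a)"
    by (simp add: b_def algebra_simps)
  also have "\<dots> \<in> L"
    by (intro rmod.subspace_diff[OF L(1)] rmod.subspace_scale[OF L(1)] top Suc.prems(1))
  finally have "(\<tau> * t) * b \<in> L" .
  moreover have "\<forall>e>M + M. degree_part e (\<tau> * t) = 0"
    and top2: "degree_part (M + M) (\<tau> * t) = \<tau> * \<tau>"
    using degree_part_top_mult[of M \<tau> M t] \<tau> Suc.prems(2)
    by (simp_all add: degree_part_of_homogeneous \<tau>_def[symmetric])
  moreover have "\<forall>e\<ge>D. degree_part e b = 0"
    using Suc.prems(3) by (simp add: b_def degree_part_diff degree_part_degree_part)
  ultimately obtain k where "degree_part (M + M) (\<tau> * t) ^ k * b \<in> L" using Suc.IH by blast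
  then have k: "(\<tau> * \<tau>) ^ k * b \<in> L" by (simp only: top2)
  have "\<tau> ^ Suc (k + k) * a = \<tau> * ((\<tau> * \<tau>) ^ k * b) + (\<tau> * \<tau>) ^ k * (\<tau> * degree_part D a)"
    by (simp add: b_def power_add power_mult_distrib algebra_simps)
  also have "\<dots> \<in> L"
    by (intro rmod.subspace_add[OF L(1)] rmod.subspace_scale[OF L(1)] top k)
  finally show ?case unfolding \<tau>_def by blast
qed

text \<open>
  The colon ideal by an inhomogeneous element need not be homogeneous, but its radical is: the top
  component of each element belongs to the radical by the preceding lemma, and may then be subtracted.
\<close>

lemma graded_radical_colon:
  fixes L :: "('v::finite, 'k::comm_ring_1) mpoly set"
  assumes L: "rmod.subspace L" "graded L"
  shows "graded (radical (colon L a))"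
proof -
  let ?R = "radical (colon L a)"
  have R: "rmod.subspace ?R" by (intro subspace_radical subspace_colon L)
  obtain D where "\<forall>e>D. degree_part e a = 0" using degree_part_eventually_zero[of a] by blast
  then have D: "\<forall>e\<ge>Suc D. degree_part e a = 0" by auto
  have top: "degree_part M s \<in> ?R" if "s \<in> ?R" "\<forall>e>M. degree_part e s = 0" for s M
  proof -
    from that(1) obtain n where "s ^ n * a \<in> L" by (auto simp: radical_def colon_def)
    with top_part_annihilates[OF L this _ D, of "n * M"] degree_part_top_power[OF that(2), of n]
    obtain k where "(degree_part M s ^ n) ^ k * a \<in> L" by auto
    then show ?thesis by (auto simp: radical_def colon_def simp flip: power_mult)
  qed
  have "\<forall>e. degree_part e s \<in> ?R" if "s \<in> ?R" "\<forall>e\<ge>M. degree_part e s = 0" for s M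
    using that
  proof (induction M arbitrary: s)
    case 0
    then show ?case by (simp add: rmod.subspace_0[OF R])
  next
    case (Suc M)
    have M: "degree_part M s \<in> ?R" using Suc.prems by (intro top) auto
    have "\<forall>e. degree_part e (s - degree_part M s) \<in> ?R"
      using Suc.prems M by (intro Suc.IH rmod.subspace_diff[OF R]) (auto simp: degree_part_diff degree_part_degree_part)
    then have "degree_part e s \<in> ?R" if "e \<noteq> M" for e
      using that by (auto simp: degree_part_diff degree_part_degree_part dest: spec[of _ e])
    then show ?case using M by (intro allI) (metis)
  qed
  then have "degree_part e s \<in> ?R" if "s \<in> ?R" for e s
    using degree_part_eventually_zero[of s] that by (metis Suc_le_eq)
  then show ?thesis by (simp add: graded_def)
qed

definition homogeneous_core :: "('v::finite, 'k::comm_ring_1) mpoly set \<Rightarrow> ('v, 'k) mpoly set" where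
  "homogeneous_core Q = {p. \<forall>e. degree_part e p \<in> Q}"

lemma homogeneous_core_subset: "rmod.subspace Q \<Longrightarrow> homogeneous_core Q \<subseteq> Q"
proof
  fix p assume Q: "rmod.subspace Q" and "p \<in> homogeneous_core Q"
  then have "range (\<lambda>e. degree_part e p) \<subseteq> Q" by (auto simp: homogeneous_core_def)
  from rmod.span_minimal[OF this Q] mem_span_degree_parts[of p] show "p \<in> Q" by (rule subsetD)
qed

lemma graded_subset_core: "graded J \<Longrightarrow> J \<subseteq> Q \<Longrightarrow> J \<subseteq> homogeneous_core Q"
  by (auto simp: homogeneous_core_def graded_def)

lemma graded_core: "rmod.subspace Q \<Longrightarrow> graded (homogeneous_core Q)"
  by (auto simp: graded_def homogeneous_core_def degree_part_degree_part rmod.subspace_0)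

lemma subspace_core:
  assumes Q: "rmod.subspace Q"
  shows "rmod.subspace (homogeneous_core Q)"
proof (rule rmod.subspaceI)
  show "c * x \<in> homogeneous_core Q" if "x \<in> homogeneous_core Q" for c x
    using that by (auto simp: homogeneous_core_def degree_part_mult
        intro!: rmod.subspace_sum[OF Q] rmod.subspace_scale[OF Q])
qed (auto simp: homogeneous_core_def degree_part_add rmod.subspace_0[OF Q] intro: rmod.subspace_add[OF Q])

text \<open>
  If \<open>p * q\<close> has all its components in \<open>Q\<close>, look at the last components of \<open>p\<close> and of \<open>q\<close> that are not in
  \<open>Q\<close>, of degrees \<open>i\<close> and \<open>j\<close>. In degree \<open>i + j\<close> every other contribution to \<open>p * q\<close> lies in \<open>Q\<close>, hence so
  does the product of these two.
\<close>

lemma prime_core: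
  assumes P: "is_prime_ideal Q"
  shows "is_prime_ideal (homogeneous_core Q)"
proof -
  have Q: "rmod.subspace Q" and Q1: "1 \<notin> Q"
    and Qp: "\<And>a b. a * b \<in> Q \<Longrightarrow> a \<in> Q \<or> b \<in> Q" using P by (auto simp: is_prime_ideal_iff)
  have last: "\<exists>i. degree_part i p \<notin> Q \<and> (\<forall>e>i. degree_part e p \<in> Q)" if "p \<notin> homogeneous_core Q" for p
  proof -
    from that obtain e where e: "degree_part e p \<notin> Q" by (auto simp: homogeneous_core_def)
    obtain N where N: "\<forall>e>N. degree_part e p = 0" using degree_part_eventually_zero[of p] by blast
    have bd: "\<forall>i. degree_part i p \<notin> Q \<longrightarrow> i \<le> N"
      using N rmod.subspace_0[OF Q] by (metis not_le)
    let ?G = "GREATEST i. degree_part i p \<notin> Q"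
    have "degree_part ?G p \<notin> Q" by (rule GreatestI_nat[where P = "\<lambda>i. degree_part i p \<notin> Q" and k = e and b = N])
      (use e bd in auto)
    moreover have "degree_part i p \<in> Q" if "i > ?G" for i
      using Greatest_le_nat[of "\<lambda>i. degree_part i p \<notin> Q" i N] bd that by fastforce
    ultimately show ?thesis by blast
  qed
  have "p \<in> homogeneous_core Q \<or> q \<in> homogeneous_core Q" if pq: "p * q \<in> homogeneous_core Q" for p q
  proof (rule ccontr)
    assume "\<not> (p \<in> homogeneous_core Q \<or> q \<in> homogeneous_core Q)"
    then obtain i j where i: "degree_part i p \<notin> Q" "\<forall>e>i. degree_part e p \<in> Q"
      and j: "degree_part j q \<notin> Q" "\<forall>e>j. degree_part e q \<in> Q" using last by meson
    let ?h = "\<lambda>a. degree_part a p * degree_part (i + j - a) q"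
    have "?h a \<in> Q" if "a \<in> {..i + j} - {i}" for a
    proof (cases "a > i")
      case True
      then have "degree_part a p \<in> Q" using i(2) by blast
      from rmod.subspace_scale[OF Q this, of "degree_part (i + j - a) q"] show ?thesis
        by (simp add: mult.commute)
    next
      case False
      then have "i + j - a > j" using that by auto
      then have "degree_part (i + j - a) q \<in> Q" using j(2) by blast
      then show ?thesis by (rule rmod.subspace_scale[OF Q])
    qed
    then have "(\<Sum>a\<in>{..i + j} - {i}. ?h a) \<in> Q" by (rule rmod.subspace_sum[OF Q])
    moreover have "(\<Sum>a\<le>i + j. ?h a) = ?h i + (\<Sum>a\<in>{..i + j} - {i}. ?h a)"
      by (rule sum.remove) auto
    moreover have "(\<Sum>a\<le>i + j. ?h a) \<in> Q"
      using pq by (simp add: homogeneous_core_def flip: degree_part_mult)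
    ultimately have "?h i + (\<Sum>a\<in>{..i + j} - {i}. ?h a) - (\<Sum>a\<in>{..i + j} - {i}. ?h a) \<in> Q"
      by (intro rmod.subspace_diff[OF Q]) simp_all
    then have "?h i \<in> Q" by (simp only: add_diff_cancel_right')
    then show False using Qp i(1) j(1) by auto
  qed
  moreover have "1 \<notin> homogeneous_core Q" using Q1 homogeneous_core_subset[OF Q] by blast
  ultimately show ?thesis using subspace_core[OF Q] by (simp add: is_prime_ideal_iff)
qed

section \<open>Dimension zero of the vanishing space\<close>

text \<open>
  Dimension at most zero of \<open>V(J)\<close>, in terms of primes: there is no strict inclusion between points.
\<close>

definition zero_dimensional :: "('v::finite, 'k::field) mpoly set \<Rightarrow> bool" where
  "zero_dimensional J \<longleftrightarrow> (\<forall>P Q. is_prime_ideal P \<and> graded P \<and> is_prime_ideal Q \<and> graded Q \<and>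
     J \<subseteq> P \<and> P \<subseteq> Q \<and> (\<exists>i. Var i \<notin> Q) \<longrightarrow> P = Q)"

lemma irrelevant_ideal_subset_iff:
  assumes P: "rmod.subspace P"
  shows "irrelevant_ideal \<subseteq> P \<longleftrightarrow> (\<forall>i. Var i \<in> P)"
proof
  assume "irrelevant_ideal \<subseteq> P"
  then have "range Var \<subseteq> P"
    unfolding irrelevant_ideal_def ideal_gen_eq_span by (rule subset_trans[OF rmod.span_superset])
  then show "\<forall>i. Var i \<in> P" by auto
next
  assume "\<forall>i. Var i \<in> P"
  then have "range Var \<subseteq> P" by auto
  from rmod.span_minimal[OF this P] show "irrelevant_ideal \<subseteq> P"
    by (simp add: irrelevant_ideal_def ideal_gen_eq_span)
qed

text \<open>
  Open sets are stable under passing to smaller primes, since the basic ones are.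
\<close>

lemma zariski_open_generization:
  assumes "openin zariski_topology U" "Q \<in> U" "P \<subseteq> Q" "P \<in> proj_points"
  shows "P \<in> U"
proof -
  have "generate_topology_on {{P \<in> proj_points. g \<notin> P} |g. \<exists>d. homogeneous d g} U"
    using assms(1) by (simp add: zariski_topology_def openin_topology_generated_by_iff)
  then show ?thesis using assms(2-)
    by (induction arbitrary: rule: generate_topology_on.induct) auto
qed

lemma topspace_vanishing_space: "topspace (vanishing_space J) = {P \<in> proj_points. J \<subseteq> P}"
proof -
  have "homogeneous 0 (1 :: ('a, 'b) mpoly)" by (simp add: homogeneous_def)
  moreover have "{P \<in> proj_points. (1 :: ('a, 'b) mpoly) \<notin> P} = proj_points"
    by (auto simp: proj_points_def is_prime_ideal_iff)
  ultimately have "topspace zariski_topology = (proj_points :: ('a, 'b) mpoly set set)"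
    unfolding zariski_topology_def topology_generated_by_topspace by fastforce
  then show ?thesis by (auto simp: vanishing_space_def)
qed

text \<open>
  The set in question is the closure of the point \<open>Q\<close>: a closed set that contains \<open>Q\<close> contains every
  larger prime. So if it is a union of two closed sets, the one that contains \<open>Q\<close> is everything.
\<close>

lemma irreducible_closed_specializations:
  fixes Q J :: "('v::finite, 'k::field) mpoly set"
  assumes Q: "Q \<in> proj_points" "J \<subseteq> Q"
  shows "irreducible_closed (vanishing_space J) {P \<in> proj_points. Q \<subseteq> P}"
proof -
  let ?V = "{P \<in> proj_points. J \<subseteq> P}"
  let ?C = "{P \<in> proj_points. Q \<subseteq> P}"
  have SQ: "rmod.subspace Q" and gQ: "graded Q"
    using Q(1) by (auto simp: proj_points_def is_prime_ideal_iff homogeneous_ideal_iff)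
  have "openin (vanishing_space J) (?V - ?C)"
  proof -
    define G where "G = {g \<in> Q. \<exists>d. homogeneous d g}"
    define U where "U = (\<Union>g\<in>G. {P \<in> proj_points. g \<notin> P})"
    have "openin zariski_topology {P \<in> proj_points. g \<notin> P}" if "g \<in> G" for g
      unfolding zariski_topology_def
      using that by (intro topology_generated_by_Basis) (auto simp: G_def)
    then have "openin zariski_topology U" unfolding U_def by (intro openin_Union) auto
    moreover have "?V - ?C = ?V \<inter> U"
    proof -
      have "\<exists>g\<in>G. g \<notin> P" if "P \<in> proj_points" "\<not> Q \<subseteq> P" for P
      proof -
        from that(2) obtain q where q: "q \<in> Q" "q \<notin> P" by blast
        have SP: "rmod.subspace P" and gP: "graded P"
          using that(1) by (auto simp: proj_points_def is_prime_ideal_iff homogeneous_ideal_iff)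
        obtain e where "degree_part e q \<notin> P" using q(2) graded_mem_iff[OF SP gP] by blast
        moreover have "degree_part e q \<in> G"
          using gQ q(1) homogeneous_degree_part[of e q] by (auto simp: graded_def G_def)
        ultimately show ?thesis by (rule bexI)
      qed
      then show ?thesis unfolding U_def by (auto simp: G_def)
    qed
    ultimately show ?thesis
      unfolding vanishing_space_def openin_subtopology by (auto simp: Int_commute)
  qed
  moreover have "?C \<subseteq> ?V" using Q(2) by auto
  ultimately have closed: "closedin (vanishing_space J) ?C"
    by (simp add: closedin_def topspace_vanishing_space)
  have QC: "Q \<in> ?C" using Q(1) by simp
  have whole: "?C = A"
    if "closedin (vanishing_space J) A" "Q \<in> A" "A \<subseteq> ?C" for A
  proof -
    have "openin (vanishing_space J) (?V - A)"
      using that(1) by (simp add: closedin_def topspace_vanishing_space)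
    then obtain U where U: "openin zariski_topology U" "?V - A = U \<inter> ?V"
      unfolding vanishing_space_def openin_subtopology by blast
    have "P \<in> A" if "P \<in> ?C" for P
    proof (rule ccontr)
      assume "P \<notin> A"
      then have "P \<in> U" using U(2) that Q(2) by blast
      then have "Q \<in> U" using zariski_open_generization[OF U(1)] that Q(1) by blast
      then show False using U(2) Q \<open>Q \<in> A\<close> by blast
    qed
    then show ?thesis using that(3) by blast
  qed
  show ?thesis unfolding irreducible_closed_def
  proof (intro conjI allI impI closed)
    show "?C \<noteq> {}" using QC by blast
    fix A B
    assume AB: "closedin (vanishing_space J) A \<and> closedin (vanishing_space J) B \<and> ?C = A \<union> B"
    then have "Q \<in> A \<or> Q \<in> B" using QC by blast
    then show "?C = A \<or> ?C = B"
    proof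
      assume "Q \<in> A"
      with AB whole[of A] show ?thesis by blast
    next
      assume "Q \<in> B"
      with AB whole[of B] show ?thesis by blast
    qed
  qed
qed

text \<open>
  A strict inclusion of points would give a chain of two irreducible closed sets, their closures.
\<close>

lemma zero_dimensional_if_krull_dim:
  fixes J :: "('v::finite, 'k::field) mpoly set"
  assumes "krull_dim (vanishing_space J) = 0"
  shows "zero_dimensional J"
  unfolding zero_dimensional_def
proof (intro allI impI)
  fix P Q :: "('v, 'k) mpoly set"
  assume *: "is_prime_ideal P \<and> graded P \<and> is_prime_ideal Q \<and> graded Q \<and>
     J \<subseteq> P \<and> P \<subseteq> Q \<and> (\<exists>i. Var i \<notin> Q)"
  then have SP: "rmod.subspace P" and SQ: "rmod.subspace Q" by (auto simp: is_prime_ideal_iff)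
  have P: "P \<in> proj_points" and Q: "Q \<in> proj_points"
    using * by (auto simp: proj_points_def homogeneous_ideal_iff SP SQ irrelevant_ideal_subset_iff)
  show "P = Q"
  proof (rule ccontr)
    assume "P \<noteq> Q"
    define C where "C i = (if i = 0 then {K \<in> proj_points. Q \<subseteq> K} else {K \<in> proj_points. P \<subseteq> K})"
      for i :: nat
    have "\<forall>i\<le>1. irreducible_closed (vanishing_space J) (C i)"
      using irreducible_closed_specializations P Q * by (auto simp: C_def)
    moreover have "P \<in> C 1" "P \<notin> C 0" "C 0 \<subseteq> C 1"
      using P \<open>P \<noteq> Q\<close> * by (auto simp: C_def)
    then have "\<forall>i<1. C i \<subset> C (Suc i)" by auto
    ultimately have "ereal (real 1) \<le> krull_dim (vanishing_space J)"
      unfolding krull_dim_def by (intro Sup_upper) blast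
    then show False using assms by simp
  qed
qed

section \<open>Symbolic powers as saturations\<close>

text \<open>
  The saturation with respect to the irrelevant ideal, written one variable at a time so that it can be
  compared with radicals of colon ideals.
\<close>

definition torsion_saturation :: "('v, 'k::field) mpoly set \<Rightarrow> ('v, 'k) mpoly set" where
  "torsion_saturation L = {a. \<forall>i. Var i \<in> radical (colon L a)}"

lemma subspace_torsion_saturation:
  assumes L: "rmod.subspace L"
  shows "rmod.subspace (torsion_saturation L)"
proof (rule rmod.subspaceI)
  show "0 \<in> torsion_saturation L"
    using rmod.subspace_0[OF L] by (simp add: torsion_saturation_def radical_def colon_def)
  show "c * x \<in> torsion_saturation L" if "x \<in> torsion_saturation L" for c x
    unfolding torsion_saturation_def radical_def colon_def
  proof (intro CollectI allI)
    fix i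
    from that obtain n where "Var i ^ n * x \<in> L"
      by (auto simp: torsion_saturation_def radical_def colon_def)
    from rmod.subspace_scale[OF L this, of c] have "Var i ^ n * (c * x) \<in> L" by (simp add: ac_simps)
    then show "\<exists>n. Var i ^ n \<in> {a. a * (c * x) \<in> L}" by blast
  qed
  show "x + y \<in> torsion_saturation L" if "x \<in> torsion_saturation L" "y \<in> torsion_saturation L" for x y
    unfolding torsion_saturation_def radical_def colon_def
  proof (intro CollectI allI)
    fix i
    from that(1) obtain n where n: "Var i ^ n * x \<in> L"
      by (auto simp: torsion_saturation_def radical_def colon_def)
    from that(2) obtain m where m: "Var i ^ m * y \<in> L"
      by (auto simp: torsion_saturation_def radical_def colon_def)
    have "Var i ^ (n + m) * (x + y) = Var i ^ m * (Var i ^ n * x) + Var i ^ n * (Var i ^ m * y)"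
      by (simp add: power_add algebra_simps)
    also have "\<dots> \<in> L"
      using rmod.subspace_scale[OF L n] rmod.subspace_scale[OF L m] by (rule rmod.subspace_add[OF L])
    finally show "\<exists>n. Var i ^ n \<in> {a. a * (x + y) \<in> L}" by blast
  qed
qed

lemma mem_symbolic_power_iff:
  assumes "rmod.subspace L"
  shows "a \<in> symbolic_power L m \<longleftrightarrow>
    (\<forall>P\<in>associated_primes L. \<exists>s. s \<notin> P \<and> s * a \<in> ideal_power L m)"
proof -
  have "Fract a 1 \<in> localized_ideal K P \<longleftrightarrow> (\<exists>s. s \<notin> P \<and> s * a \<in> K)"
    if "P \<in> associated_primes L" for P K
  proof -
    have "0 \<in> P" using that by (auto simp: associated_primes_def is_prime_ideal_iff rmod.subspace_0)
    then have nz: "s \<noteq> 0" if "s \<notin> P" for s using that by auto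
    have eq: "Fract a 1 = Fract b s \<longleftrightarrow> b = s * a" if "s \<notin> P" for s b
      using nz[OF that] by (auto simp: eq_fract mult.commute)
    have "Fract a 1 \<in> localized_ideal K P \<longleftrightarrow> (\<exists>b s. s \<notin> P \<and> Fract a 1 = Fract b s \<and> b \<in> K)"
      by (auto simp: localized_ideal_def)
    also have "\<dots> \<longleftrightarrow> (\<exists>b s. s \<notin> P \<and> b = s * a \<and> b \<in> K)" by (simp add: eq cong: conj_cong)
    finally show ?thesis by auto
  qed
  then show ?thesis by (simp add: symbolic_power_def)
qed

text \<open>
  The assumption \<open>sat\<close> says that the irrelevant ideal annihilates no nonzero element of the quotient by
  \<open>J\<close>, so that every associated prime of \<open>J\<close> misses some variable. For the converse inclusion, a variable
  outside the radical \<open>R\<close> of the colon ideal leads to a prime \<open>Q\<close> above \<open>R\<close> and an associated prime \<open>P\<close>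
  below it.
\<close>

lemma symbolic_power_eq_saturation:
  fixes J :: "('v::{finite,linorder}, 'k::field) mpoly set"
  assumes J: "rmod.subspace J" "graded J" and dim: "zero_dimensional J"
    and sat: "\<And>x. (\<And>i. Var i * x \<in> J) \<Longrightarrow> x \<in> J"
  shows "symbolic_power J m = torsion_saturation (ideal_power J m)"
proof (intro equalityI subsetI)
  fix a assume a: "a \<in> torsion_saturation (ideal_power J m)"
  show "a \<in> symbolic_power J m"
    unfolding mem_symbolic_power_iff[OF J(1)]
  proof
    fix P assume "P \<in> associated_primes J"
    then obtain x where P: "is_prime_ideal P" and x: "P = {s. s * x \<in> J}"
      by (auto simp: associated_primes_def)
    have "\<exists>i. Var i \<notin> P"
    proof (rule ccontr)
      assume "\<nexists>i. Var i \<notin> P"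
      then have "x \<in> J" using sat[of x] by (auto simp: x)
      then have "1 \<in> P" by (simp add: x)
      then show False using P by (simp add: is_prime_ideal_iff)
    qed
    then obtain i where i: "Var i \<notin> P" by blast
    obtain N where "Var i ^ N * a \<in> ideal_power J m"
      using a by (auto simp: torsion_saturation_def radical_def colon_def)
    then show "\<exists>s. s \<notin> P \<and> s * a \<in> ideal_power J m" using i prime_power_mem[OF P] by blast
  qed
next
  fix a assume a: "a \<in> symbolic_power J m"
  define L where "L = ideal_power J m"
  define R where "R = radical (colon L a)"
  have L: "rmod.subspace L" "graded L"
    unfolding L_def by (intro subspace_ideal_power graded_ideal_power J)+
  have R: "rmod.subspace R" "graded R"
    unfolding R_def by (intro subspace_radical subspace_colon graded_radical_colon L)+
  have "Var i \<in> R" for i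
  proof (rule ccontr)
    assume "Var i \<notin> R"
    then have "Var i \<notin> radical R" unfolding R_def by (auto simp: radical_def[of "radical _"] dest: radical_idem)
    from prime_ideal_avoiding[OF R(1) this] obtain Q
      where Q: "is_prime_ideal Q" "R \<subseteq> Q" "Var i \<notin> Q" .
    have SQ: "rmod.subspace Q" using Q by (simp add: is_prime_ideal_iff)
    let ?Q = "homogeneous_core Q"
    have RQ: "R \<subseteq> ?Q" by (rule graded_subset_core[OF R(2) Q(2)])
    (* The homogeneous core of P is a point of V(J) below Q, so dimension zero collapses
       core P, P and core Q; but s lies in R and not in P. *)
    have LR: "L \<subseteq> R"
    proof
      fix y assume "y \<in> L"
      then have "y \<in> colon L a" using rmod.subspace_scale[OF L(1), of y a] by (simp add: colon_def mult.commute)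
      then show "y \<in> R" unfolding R_def using subset_radical by blast
    qed
    have "J \<subseteq> ?Q"
    proof
      fix y assume "y \<in> J"
      then have "y ^ m \<in> ?Q" using power_mem_ideal_power[OF J(1)] LR RQ by (auto simp: L_def)
      then show "y \<in> ?Q" by (rule prime_power_mem[OF prime_core[OF Q(1)]])
    qed
    from associated_prime_below[OF J(1) prime_core[OF Q(1)] this] obtain P
      where P: "P \<in> associated_primes J" "P \<subseteq> ?Q" .
    have Pp: "is_prime_ideal P" using P by (simp add: associated_primes_def)
    then have SP: "rmod.subspace P" by (simp add: is_prime_ideal_iff)
    have "J \<subseteq> P"
      using P(1) rmod.subspace_scale[OF J(1)] by (auto simp: associated_primes_def mult.commute)
    then have "J \<subseteq> homogeneous_core P" by (rule graded_subset_core[OF J(2)])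
    moreover have "homogeneous_core P \<subseteq> ?Q" using homogeneous_core_subset[OF SP] P(2) by blast
    moreover have "Var i \<notin> ?Q" using homogeneous_core_subset[OF SQ] Q(3) by blast
    ultimately have "homogeneous_core P = ?Q"
      using dim prime_core[OF Pp] prime_core[OF Q(1)] graded_core[OF SP] graded_core[OF SQ]
      unfolding zero_dimensional_def by blast
    then have "R \<subseteq> P" using RQ homogeneous_core_subset[OF SP] by blast
    moreover
    obtain s where "s \<notin> P" "s * a \<in> L"
      using a P(1) by (auto simp: mem_symbolic_power_iff[OF J(1)] L_def)
    then have "s \<in> colon L a" by (simp add: colon_def)
    then have "s \<in> R" unfolding R_def by (rule subsetD[OF subset_radical])
    ultimately show False using \<open>s \<notin> P\<close> by blast
  qed
  then show "a \<in> torsion_saturation (ideal_power J m)"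
    by (simp add: torsion_saturation_def R_def L_def)
qed

section \<open>Dimension counts in vector spaces\<close>

text \<open>
  The dimension formula, for subspaces of finite dimension inside a space of arbitrary dimension. A
  basis of the intersection is extended to a basis of \<open>A\<close> and further, by elements of \<open>B\<close>, to a basis of
  the sum.
\<close>

lemma (in vector_space) dim_sum_Int:
  assumes A: "subspace A" and B: "subspace B"
    and fin: "finite F" "A \<subseteq> span F" "B \<subseteq> span F"
  shows "dim {x + y |x y. x \<in> A \<and> y \<in> B} + dim (A \<inter> B) = dim A + dim B"
proof -
  have finI: "finite S" if "independent S" "S \<subseteq> A \<union> B" for S
    using independent_span_bound[OF fin(1) that(1)] that(2) fin by blast
  obtain C where C: "C \<subseteq> A \<inter> B" "independent C" "A \<inter> B \<subseteq> span C" "card C = dim (A \<inter> B)"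
    by (rule basis_exists)
  obtain BA where BA: "C \<subseteq> BA" "BA \<subseteq> A" "independent BA" "A \<subseteq> span BA"
    using maximal_independent_subset_extend[of C A] C by blast
  obtain E where E: "BA \<subseteq> E" "E \<subseteq> A \<union> B" "independent E" "A \<union> B \<subseteq> span E"
    using maximal_independent_subset_extend[of BA "A \<union> B"] BA by blast
  define D where "D = E - BA"
  have finE: "finite E" using finI E by blast
  have spBA: "span BA = A" using BA A by (intro span_subspace)
  have DB: "D \<subseteq> B"
  proof
    fix x assume x: "x \<in> D"
    have "x \<notin> A"
    proof
      assume "x \<in> A"
      then have "x \<in> span BA" using BA by blast
      moreover have "BA \<subseteq> E - {x}" using E(1) x by (auto simp: D_def)
      ultimately have "x \<in> span (E - {x})" using span_mono by blast
      then show False using E(3) x by (auto simp: dependent_def D_def)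
    qed
    then show "x \<in> B" using x E(2) by (auto simp: D_def)
  qed
  have CD: "C \<union> D \<subseteq> B" using DB C by blast
  have "B \<subseteq> span (C \<union> D)"
  proof
    fix b assume b: "b \<in> B"
    then have "b \<in> span (BA \<union> D)" using E(1,4) by (auto simp: D_def Un_absorb1)
    then obtain a d where ad: "b = a + d" "a \<in> span BA" "d \<in> span D" by (auto simp: span_Un)
    have "d \<in> B" using span_minimal[OF DB B] ad(3) by blast
    then have "b - d \<in> B" using subspace_diff[OF B b] by blast
    then have "a \<in> A \<inter> B" using ad spBA by simp
    then have "a \<in> span C" using C(3) by blast
    then show "b \<in> span (C \<union> D)" unfolding span_Un ad(1) using ad(3) by blast
  qed
  moreover have "independent (C \<union> D)"
    using E BA(1) by (intro independent_mono[OF E(3)]) (auto simp: D_def)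
  ultimately have dB: "card (C \<union> D) = dim B" using CD by (intro basis_card_eq_dim)
  have dA: "card BA = dim A" using BA by (intro basis_card_eq_dim)
  have dE: "card E = dim {x + y |x y. x \<in> A \<and> y \<in> B}"
  proof (rule basis_card_eq_dim[OF _ _ E(3)])
    have sE: "subspace (span E)" by simp
    show "E \<subseteq> {x + y |x y. x \<in> A \<and> y \<in> B}"
    proof
      fix e assume "e \<in> E"
      then consider "e \<in> A" | "e \<in> B" using E(2) by blast
      then show "e \<in> {x + y |x y. x \<in> A \<and> y \<in> B}"
      proof cases
        case 1
        then show ?thesis using subspace_0[OF B] by (intro CollectI exI[of _ e] exI[of _ 0]) simp
      next
        case 2
        then show ?thesis using subspace_0[OF A] by (intro CollectI exI[of _ 0] exI[of _ e]) simp
      qed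
    qed
    show "{x + y |x y. x \<in> A \<and> y \<in> B} \<subseteq> span E" using E(4) by (auto intro!: span_add)
  qed
  have "card (C \<union> D) = card C + card D"
    using finE E(1) BA(1) by (intro card_Un_disjoint) (auto simp: D_def intro: finite_subset)
  moreover have "card E = card BA + card D"
    unfolding D_def using finE E(1) card_mono[OF finE E(1)]
    by (simp add: card_Diff_subset finite_subset)
  ultimately show ?thesis using dA dB dE C(4) by simp
qed

lemma (in vector_space) complement_basis:
  assumes U: "subspace U" "U \<subseteq> W" and fin: "finite F" "W \<subseteq> span F"
  obtains D where "finite D" "D \<subseteq> W" "card D + dim U = dim W"
    "\<And>w. w \<in> W \<Longrightarrow> \<exists>d\<in>span D. w - d \<in> U"
proof -
  obtain C where C: "C \<subseteq> U" "independent C" "U \<subseteq> span C" "card C = dim U"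
    by (rule basis_exists)
  obtain E where E: "C \<subseteq> E" "E \<subseteq> W" "independent E" "W \<subseteq> span E"
    using maximal_independent_subset_extend[of C W] C U by blast
  have finE: "finite E" using independent_span_bound[OF fin(1) E(3)] E(2) fin(2) by blast
  have "card E = dim W" using E by (intro basis_card_eq_dim)
  then have card: "card (E - C) + dim U = dim W"
    using finE E(1) card_mono[OF finE E(1)] C(4) by (simp add: card_Diff_subset finite_subset)
  have "\<exists>d\<in>span (E - C). w - d \<in> U" if "w \<in> W" for w
  proof -
    have "span (C \<union> (E - C)) = span E" using E(1) by (simp add: Un_absorb1)
    then have "w \<in> span (C \<union> (E - C))" using that E(4) by blast
    then obtain c d where "w = c + d" "c \<in> span C" "d \<in> span (E - C)" unfolding span_Un by blast
    moreover have "span C \<subseteq> U" using C(1) U(1) by (rule span_minimal)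
    ultimately show ?thesis by (intro bexI[of _ d]) auto
  qed
  then show ?thesis using that[of "E - C"] finE E(2) card by blast
qed

text \<open>
  Stated for families and not for sets, so that repeated members are excluded as well.
\<close>

lemma (in vector_space) spanning_family_independent:
  assumes fin: "finite X" and sp: "W \<subseteq> span (g ` X)" and card: "card X \<le> dim W"
    and zero: "(\<Sum>x\<in>X. c x *s g x) = 0" and x: "x \<in> X"
  shows "c x = 0"
proof (rule ccontr)
  assume c: "c x \<noteq> 0"
  let ?S = "span (g ` (X - {x}))"
  have "c x *s g x + (\<Sum>y\<in>X - {x}. c y *s g y) = 0"
    using zero fin x by (simp add: sum.remove)
  then have "c x *s g x = - (\<Sum>y\<in>X - {x}. c y *s g y)"
    by (simp add: eq_neg_iff_add_eq_0)
  also have "\<dots> \<in> ?S" by (intro span_neg span_sum span_scale span_base) auto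
  finally have "inverse (c x) *s (c x *s g x) \<in> ?S" by (rule span_scale)
  then have gx: "g x \<in> ?S" using c by simp
  have "g ` X \<subseteq> ?S"
  proof
    fix v assume "v \<in> g ` X"
    then obtain y where "y \<in> X" "v = g y" by blast
    then show "v \<in> ?S" using gx by (cases "y = x") (auto intro: span_base)
  qed
  then have "W \<subseteq> ?S" using sp span_minimal[of "g ` X" ?S] by blast
  then have "dim W \<le> card (g ` (X - {x}))" using fin by (intro dim_le_card) auto
  also have "\<dots> \<le> card (X - {x})" using fin by (intro card_image_le) simp
  also have "\<dots> < card X" using fin x by (rule card_Diff1_less)
  finally show False using card by simp
qed

lemma Const_mult: "Const a * Const b = Const (a * b :: 'k::comm_semiring_1)"
  by (simp add: Const_def mult_single)

interpretation kvs: vector_space "\<lambda>(c :: 'k::field) (p :: ('v, 'k) mpoly). Const c * p"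
proof
  fix a b :: 'k and x y :: "('v, 'k) mpoly"
  show "Const a * (Const b * x) = Const (a * b) * x"
    by (simp add: Const_mult[symmetric] mult.assoc)
qed (simp_all add: Const_def distrib_left distrib_right single_add)

(* Folding products into Const (a * b) works against normalisation by associativity. *)
declare kvs.scale_scale [simp del]

lemma kvs_subspace_ideal: "rmod.subspace J \<Longrightarrow> kvs.subspace J"
  by (rule kvs.subspaceI) (simp_all add: rmod.subspace_0 rmod.subspace_add rmod.subspace_scale)

section \<open>Spaces of forms\<close>

definition monomial :: "('v \<Rightarrow>\<^sub>0 nat) \<Rightarrow> ('v, 'k::field) mpoly" where
  "monomial t = Poly_Mapping.single t 1"

definition forms :: "nat \<Rightarrow> ('v::finite, 'k::field) mpoly set" where
  "forms e = {p. homogeneous e p}"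

definition exponents :: "nat \<Rightarrow> ('v::finite \<Rightarrow>\<^sub>0 nat) set" where
  "exponents e = {t. total_degree t = e}"

lemma monomial_add: "monomial (s + t) = monomial s * monomial t"
  by (simp add: monomial_def mult_single)

lemma monomial_0 [simp]: "monomial 0 = 1"
  by (simp add: monomial_def)

lemma Var_eq_monomial: "Var i = monomial (Poly_Mapping.single i 1)"
  by (simp add: Var_def monomial_def)

lemma single_eq_Const_monomial: "Poly_Mapping.single t c = Const c * monomial t"
  by (simp add: Const_def monomial_def mult_single)

lemma homogeneous_monomial: "homogeneous (total_degree t) (monomial t)"
  by (simp add: homogeneous_def monomial_def total_degree_def)

lemma homogeneous_Const: "homogeneous 0 (Const c)"
  by (simp add: homogeneous_def Const_def)

lemma lookup_le_tdeg: "Poly_Mapping.lookup t i \<le> total_degree t"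
  unfolding total_degree_def by (rule member_le_sum) auto

lemma finite_exponents_bounded:
  "finite {t :: 'v::finite \<Rightarrow>\<^sub>0 nat. \<forall>i. Poly_Mapping.lookup t i \<le> N}"
proof -
  have "Poly_Mapping.lookup ` {t :: 'v \<Rightarrow>\<^sub>0 nat. \<forall>i. Poly_Mapping.lookup t i \<le> N}
      \<subseteq> PiE UNIV (\<lambda>_. {..N})"
    by auto
  moreover have "finite (PiE (UNIV :: 'v set) (\<lambda>_. {..N}))" by (intro finite_PiE) auto
  ultimately have "finite (Poly_Mapping.lookup ` {t :: 'v \<Rightarrow>\<^sub>0 nat. \<forall>i. Poly_Mapping.lookup t i \<le> N})"
    by (rule finite_subset)
  then show ?thesis by (rule finite_imageD) (auto simp: inj_on_def poly_mapping_eqI)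
qed

lemma finite_exponents: "finite (exponents e)"
  by (rule finite_subset[OF _ finite_exponents_bounded[of e]])
    (auto simp: exponents_def intro: order_trans[OF lookup_le_tdeg])

lemma subspace_forms: "kvs.subspace (forms e)"
proof (rule kvs.subspaceI)
  fix c p assume "p \<in> forms e"
  then show "Const c * p \<in> forms e"
    using homogeneous_mult[OF homogeneous_Const, of e p c] by (simp add: forms_def)
qed (auto simp: forms_def homogeneous_iff_degree_part degree_part_add)

lemma forms_subset_span: "forms e \<subseteq> kvs.span (monomial ` exponents e)"
proof
  fix p assume "p \<in> (forms e :: ('a, 'b) mpoly set)"
  then have "monomial t \<in> kvs.span (monomial ` exponents e)" if "t \<in> Poly_Mapping.keys p" for t
    using that by (intro kvs.span_base) (auto simp: forms_def homogeneous_def exponents_def total_degree_def)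
  then have "(\<Sum>t\<in>Poly_Mapping.keys p. Const (Poly_Mapping.lookup p t) * monomial t) \<in> kvs.span (monomial ` exponents e)"
    by (intro kvs.span_sum kvs.span_scale)
  then show "p \<in> kvs.span (monomial ` exponents e)"
    by (simp flip: single_eq_Const_monomial mpoly_sum_single)
qed

lemma dim_forms: "kvs.dim (forms e :: ('v::finite, 'k::field) mpoly set) = card (exponents e :: ('v \<Rightarrow>\<^sub>0 nat) set)"
proof (rule kvs.dim_unique[OF _ forms_subset_span])
  have inj: "inj_on (monomial :: _ \<Rightarrow> ('v, 'k) mpoly) A" for A
  proof (rule inj_onI)
    fix s t :: "'v \<Rightarrow>\<^sub>0 nat"
    assume "monomial s = (monomial t :: ('v, 'k) mpoly)"
    then have "Poly_Mapping.keys (monomial s :: ('v, 'k) mpoly) = Poly_Mapping.keys (monomial t :: ('v, 'k) mpoly)"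
      by simp
    then show "s = t" by (simp add: monomial_def)
  qed
  show "monomial ` exponents e \<subseteq> (forms e :: ('v, 'k) mpoly set)"
    by (auto simp: forms_def exponents_def intro: homogeneous_monomial)
  show "card (monomial ` exponents e :: ('v, 'k) mpoly set) = card (exponents e :: ('v \<Rightarrow>\<^sub>0 nat) set)"
    by (rule card_image[OF inj])
  show "kvs.independent (monomial ` exponents e :: ('v, 'k) mpoly set)"
  proof (rule kvs.independent_if_scalars_zero)
    fix c :: "('v, 'k) mpoly \<Rightarrow> 'k" and x :: "('v, 'k) mpoly"
    assume s: "(\<Sum>x\<in>monomial ` exponents e. Const (c x) * x) = 0" and "x \<in> monomial ` exponents e"
    then obtain t :: "'v \<Rightarrow>\<^sub>0 nat" where t: "t \<in> exponents e" "x = monomial t" by blast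
    from s have "(\<Sum>t\<in>exponents e. Const (c (monomial t)) * monomial t) = (0 :: ('v, 'k) mpoly)"
      by (simp add: sum.reindex[OF inj])
    then have "Poly_Mapping.lookup (\<Sum>t\<in>exponents e. Poly_Mapping.single t (c (monomial t))) t = 0"
      by (simp add: single_eq_Const_monomial)
    then have "(\<Sum>s\<in>exponents e. if s = t then c (monomial s) else 0) = 0"
      by (simp add: lookup_sum lookup_single when_def)
    then show "c x = 0" using t by (simp add: finite_exponents)
  qed (simp add: finite_exponents)
qed

lemma dim_mult_image:
  fixes h :: "('v::linorder, 'k::field) mpoly"
  assumes "h \<noteq> 0"
  shows "kvs.dim ((\<lambda>p. p * h) ` V) = kvs.dim V"
proof -
  interpret m: module_hom "\<lambda>c p. Const c * p" "\<lambda>c p. Const c * p" "\<lambda>p :: ('v, 'k) mpoly. p * h"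
    by unfold_locales (simp_all add: algebra_simps)
  have inj: "inj_on (\<lambda>p. p * h) A" for A
    using assms by (auto intro: inj_onI)
  obtain B where B: "B \<subseteq> V" "kvs.independent B" "V \<subseteq> kvs.span B" "card B = kvs.dim V"
    by (rule kvs.basis_exists)
  show ?thesis
  proof (rule kvs.dim_unique)
    show "(\<lambda>p. p * h) ` B \<subseteq> (\<lambda>p. p * h) ` V" using B by blast
    show "(\<lambda>p. p * h) ` V \<subseteq> kvs.span ((\<lambda>p. p * h) ` B)" using B(3) m.span_image by blast
    show "kvs.independent ((\<lambda>p. p * h) ` B)" using m.independent_injective_image[OF B(2) inj] .
    show "card ((\<lambda>p. p * h) ` B) = kvs.dim V" using B(4) card_image[OF inj] by metis
  qed
qed

section \<open>The Hilbert function of a regular sequence of forms\<close>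

text \<open>
  The Hilbert function of the quotient is computed one form at a time, along the initial segments of the
  index type.
\<close>

locale regular_forms =
  fixes f :: "'v::{finite,linorder} \<Rightarrow> ('v, 'k::field) mpoly" and d :: nat
  assumes regular: "regular_sequence f" and homog: "\<And>i. homogeneous d (f i)"
begin

lemma regular_cancel: "g * f i \<in> rmod.span (f ` {..<i}) \<Longrightarrow> g \<in> rmod.span (f ` {..<i})"
  using regular by (simp add: regular_sequence_def ideal_gen_eq_span)

lemma one_notin: "1 \<notin> rmod.span (range f)"
  using regular UNIV_eq_if_one_mem[OF rmod.subspace_span, of "range f"]
  by (auto simp: regular_sequence_def ideal_gen_eq_span)

lemma f_nz: "f i \<noteq> 0"
proof
  assume "f i = 0"
  then have "1 \<in> rmod.span (f ` {..<i})" using regular_cancel[of 1 i] by (simp add: rmod.span_zero)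
  then have "1 \<in> rmod.span (range f)" using rmod.span_mono[of "f ` {..<i}" "range f"] by blast
  then show False using one_notin by simp
qed

text \<open>
  Forms of degree \<open>0\<close> are constants, and nonzero constants would generate the unit ideal.
\<close>

lemma d_pos: "d > 0"
proof (rule ccontr)
  fix i :: 'v
  assume "\<not> d > 0"
  then have "f i = Const (Poly_Mapping.lookup (f i) 0)"
    using homog[of i] unfolding Const_def
    by (intro poly_mapping_eqI) (auto simp: homogeneous_def lookup_single when_def in_keys_iff simp flip: total_degree_def)
  then obtain c where c: "f i = Const c" by blast
  then have "c \<noteq> 0" using f_nz[of i] by (auto simp: Const_def)
  then have "Const (inverse c) * f i = 1" by (simp add: c Const_mult) (simp add: Const_def)
  then have "1 \<in> rmod.span (range f)" using rmod.span_scale[OF rmod.span_base[of "f i"]] by (metis rangeI)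
  then show False using one_notin by simp
qed

lemma graded_span_f: "graded (rmod.span (f ` A))"
  by (rule graded_span_homogeneous) (use homog in blast)

text \<open>
  The monomials of degree \<open>e\<close> in the ideal generated by the powers \<open>y\<^sub>i\<^sup>d\<close> with \<open>i \<in> A\<close>.
\<close>

abbreviation large_exponents :: "'v set \<Rightarrow> nat \<Rightarrow> ('v \<Rightarrow>\<^sub>0 nat) set" where
  "large_exponents A e \<equiv> {u \<in> exponents e. \<exists>i\<in>A. d \<le> Poly_Mapping.lookup u i}"

text \<open>
  The monomials that are new for \<open>b\<close> are the multiples by \<open>y\<^sub>b\<^sup>d\<close> of the monomials of degree \<open>e - d\<close> that
  were not yet counted.
\<close>

lemma large_exponents_step:
  assumes "b \<notin> A" "d \<le> e"
  shows "card (large_exponents (insert b A) e) + card (large_exponents A (e - d)) = card (large_exponents A e) + card (exponents (e - d) :: ('v \<Rightarrow>\<^sub>0 nat) set)"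
proof -
  let ?s = "\<lambda>u. u + Poly_Mapping.single b d"
  have fin: "finite (large_exponents A e)" "finite (large_exponents A (e - d))" for A e
    by (simp_all add: finite_exponents)
  have eq: "large_exponents (insert b A) e = large_exponents A e \<union> ?s ` (exponents (e - d) - large_exponents A (e - d))"
  proof (intro equalityI subsetI)
    fix u assume u: "u \<in> large_exponents (insert b A) e"
    show "u \<in> large_exponents A e \<union> ?s ` (exponents (e - d) - large_exponents A (e - d))"
    proof (cases "u \<in> large_exponents A e")
      case False
      then have "d \<le> Poly_Mapping.lookup u b" using u by auto
      then have us: "u = ?s (u - Poly_Mapping.single b d)"
        by (intro poly_mapping_eqI) (auto simp: lookup_add lookup_minus lookup_single when_def)
      have "total_degree u = e" using u by (simp add: exponents_def)
      then have "total_degree (u - Poly_Mapping.single b d) = e - d"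
        using arg_cong[OF us, of total_degree] by simp
      moreover have "\<not> d \<le> Poly_Mapping.lookup (u - Poly_Mapping.single b d) i" if "i \<in> A" for i
        using that False u assms(1) by (auto simp: lookup_minus)
      ultimately have "u - Poly_Mapping.single b d \<in> exponents (e - d) - large_exponents A (e - d)"
        by (auto simp: exponents_def)
      then show ?thesis using us by blast
    qed simp
  next
    fix u assume "u \<in> large_exponents A e \<union> ?s ` (exponents (e - d) - large_exponents A (e - d))"
    then show "u \<in> large_exponents (insert b A) e"
      using assms(2) by (auto simp: exponents_def lookup_add)
  qed
  have "card (large_exponents (insert b A) e)
      = card (large_exponents A e) + card (?s ` (exponents (e - d) - large_exponents A (e - d)))"
    unfolding eq using assms(1) finite_exponents fin
    by (intro card_Un_disjoint) (auto simp: lookup_add lookup_single when_def exponents_def split: if_splits)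
  also have "card (?s ` (exponents (e - d) - large_exponents A (e - d))) = card (exponents (e - d) - large_exponents A (e - d))"
    by (intro card_image) (simp add: inj_on_def)
  also have "\<dots> = card (exponents (e - d) :: ('v \<Rightarrow>\<^sub>0 nat) set) - card (large_exponents A (e - d))"
    by (intro card_Diff_subset fin) auto
  finally show ?thesis
    using card_mono[OF finite_exponents, of "large_exponents A (e - d)" "e - d"] by simp
qed

text \<open>
  Write \<open>J = I + (f\<^sub>b)\<close>. In degree \<open>e\<close> the space \<open>J\<^sub>e\<close> is the sum of \<open>I\<^sub>e\<close> and of the multiples of \<open>f\<^sub>b\<close> by forms of
  degree \<open>e - d\<close>, and by regularity these meet in the multiples of \<open>f\<^sub>b\<close> by \<open>I\<close> in degree \<open>e - d\<close>. The dimension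
  formula thus yields the recursion that the monomial count satisfies.
\<close>

lemma hilbert_function_initial:
  assumes "\<And>i j. i \<in> A \<Longrightarrow> j < i \<Longrightarrow> j \<in> A"
  shows "kvs.dim (rmod.span (f ` A) \<inter> forms e) = card (large_exponents A e)"
  using finite[of A] assms
proof (induction A arbitrary: e rule: finite_linorder_max_induct)
  case empty
  have "rmod.span (f ` {}) \<inter> forms e = kvs.span {}"
    using kvs.subspace_0[OF subspace_forms] by auto
  moreover have "kvs.dim (kvs.span {} :: ('v, 'k) mpoly set) = 0"
    by (simp only: kvs.dim_span kvs.dim_eq_card_independent[OF kvs.independent_empty] card.empty)
  ultimately show ?case by simp
next
  case (insert b A)
  have "x \<in> A" if "x < b" for x using insert.prems[of b x] that by auto
  then have A: "A = {..<b}" using insert.hyps(2) by (intro equalityI subsetI) simp_all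
  have IH: "kvs.dim (rmod.span (f ` A) \<inter> forms e) = card (large_exponents A e)" for e
    by (rule insert.IH) (simp add: A)
  let ?I = "rmod.span (f ` A)"
  let ?J = "rmod.span (f ` insert b A)"
  have gI: "graded ?I" by (rule graded_span_f)
  have sub: "?I \<subseteq> ?J" by (rule rmod.span_mono) auto
  have fb: "f b \<in> ?J" by (rule rmod.span_base) simp
  have Jdec: "\<exists>g. p - g * f b \<in> ?I" if "p \<in> ?J" for p
    using that by (simp add: rmod.span_insert)
  show ?case
  proof (cases "d \<le> e")
    case False
    have "p \<in> ?I" if p: "p \<in> ?J" "p \<in> forms e" for p
    proof -
      obtain g where "p - g * f b \<in> ?I" using Jdec[OF p(1)] by blast
      then have "degree_part e (p - g * f b) \<in> ?I" using gI by (simp add: graded_def)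
      then show ?thesis
        using p(2) False by (simp add: degree_part_diff degree_part_mult_homogeneous[OF homog] forms_def degree_part_of_homogeneous)
    qed
    then have "?J \<inter> forms e = ?I \<inter> forms e" using sub by blast
    moreover have "large_exponents (insert b A) e = large_exponents A e"
      using False by (auto simp: exponents_def dest: order_trans[OF _ lookup_le_tdeg])
    ultimately show ?thesis using IH by simp
  next
    case True
    let ?X = "?I \<inter> forms e" and ?Y = "(\<lambda>p. p * f b) ` forms (e - d)"
    have Yf: "?Y \<subseteq> forms e"
      using homogeneous_mult[OF _ homog, of "e - d" _ b] True by (auto simp: forms_def)
    have "?J \<inter> forms e = {x + y |x y. x \<in> ?X \<and> y \<in> ?Y}"
    proof (intro equalityI subsetI)
      fix p assume p: "p \<in> ?J \<inter> forms e"
      then obtain g where "p - g * f b \<in> ?I" using Jdec by blast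
      then have "degree_part e (p - g * f b) \<in> ?I" using gI by (simp add: graded_def)
      moreover have "degree_part e (p - g * f b) = p - degree_part (e - d) g * f b"
        using p True
        by (simp add: degree_part_diff degree_part_mult_homogeneous[OF homog] forms_def homogeneous_iff_degree_part)
      ultimately have "p - degree_part (e - d) g * f b \<in> ?X"
        using homogeneous_degree_part[of e "p - g * f b"] by (simp add: forms_def)
      moreover have "degree_part (e - d) g * f b \<in> ?Y"
        using homogeneous_degree_part by (auto simp: forms_def)
      ultimately show "p \<in> {x + y |x y. x \<in> ?X \<and> y \<in> ?Y}"
        by (intro CollectI exI[of _ "p - degree_part (e - d) g * f b"] exI[of _ "degree_part (e - d) g * f b"]) simp
    next
      fix p assume "p \<in> {x + y |x y. x \<in> ?X \<and> y \<in> ?Y}"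
      then obtain x y where xy: "p = x + y" "x \<in> ?X" "y \<in> ?Y" by blast
      have "y \<in> ?J" using xy(3) rmod.span_scale[OF fb] by auto
      then have "p \<in> ?J" using xy sub by (auto intro: rmod.span_add)
      moreover have "p \<in> forms e" using xy Yf kvs.subspace_add[OF subspace_forms] by blast
      ultimately show "p \<in> ?J \<inter> forms e" by blast
    qed
    moreover have "?X \<inter> ?Y = (\<lambda>p. p * f b) ` (?I \<inter> forms (e - d))"
    proof (intro equalityI subsetI)
      fix p assume p: "p \<in> ?X \<inter> ?Y"
      then obtain g where g: "g \<in> forms (e - d)" "p = g * f b" by blast
      then have "g \<in> ?I" using regular_cancel[of g b] p A by simp
      then show "p \<in> (\<lambda>p. p * f b) ` (?I \<inter> forms (e - d))" using g by blast
    next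
      fix p assume "p \<in> (\<lambda>p. p * f b) ` (?I \<inter> forms (e - d))"
      then obtain g where g: "g \<in> ?I" "g \<in> forms (e - d)" "p = g * f b" by blast
      then have "p \<in> ?I" using rmod.span_scale[OF g(1), of "f b"] by (simp add: mult.commute)
      then show "p \<in> ?X \<inter> ?Y" using g Yf by blast
    qed
    moreover have "kvs.dim {x + y |x y. x \<in> ?X \<and> y \<in> ?Y} + kvs.dim (?X \<inter> ?Y) = kvs.dim ?X + kvs.dim ?Y"
    proof (rule kvs.dim_sum_Int)
      show "kvs.subspace ?X"
        by (intro kvs.subspace_inter kvs_subspace_ideal rmod.subspace_span subspace_forms)
      interpret m: module_hom "\<lambda>c p. Const c * p" "\<lambda>c p. Const c * p" "\<lambda>p. p * f b"
        by unfold_locales (simp_all add: algebra_simps)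
      show "kvs.subspace ?Y" by (intro m.subspace_image subspace_forms)
      show "finite (monomial ` exponents e)" by (simp add: finite_exponents)
      show "?X \<subseteq> kvs.span (monomial ` exponents e)" "?Y \<subseteq> kvs.span (monomial ` exponents e)"
        using forms_subset_span Yf by blast+
    qed
    ultimately have "kvs.dim (?J \<inter> forms e) + card (large_exponents A (e - d))
        = card (large_exponents A e) + card (exponents (e - d) :: ('v \<Rightarrow>\<^sub>0 nat) set)"
      by (simp add: dim_mult_image[OF f_nz] IH dim_forms)
    moreover have "b \<notin> A" using A by simp
    ultimately show ?thesis using large_exponents_step[OF _ True, of b A] by simp
  qed
qed

text \<open>
  The exponents of the monomials outside the ideal generated by all \<open>y\<^sub>i\<^sup>d\<close>.
\<close>

definition box :: "('v \<Rightarrow>\<^sub>0 nat) set" where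
  "box = {t. \<forall>i. Poly_Mapping.lookup t i < d}"

lemma finite_box: "finite box"
  by (rule finite_subset[OF _ finite_exponents_bounded[of d]]) (auto simp: box_def less_imp_le)

lemma zero_in_box: "0 \<in> box"
  using d_pos by (simp add: box_def)

lemma total_degree_box:
  assumes "t \<in> box" shows "total_degree t < card (UNIV :: 'v set) * d"
proof -
  have "total_degree t < (\<Sum>i\<in>(UNIV :: 'v set). d)"
    unfolding total_degree_def using assms by (intro sum_strict_mono) (auto simp: box_def)
  then show ?thesis by simp
qed

text \<open>
  In each degree the quotient by all \<open>f\<^sub>i\<close> has as many basis elements as there are monomials in the box, so
  lifts of a basis can be indexed by the box.
\<close>

lemma complement_of_span_f:
  "\<exists>b. (\<forall>t\<in>box \<inter> exponents e. homogeneous e (b t)) \<and>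
    (\<forall>p\<in>forms e. \<exists>q\<in>kvs.span (b ` (box \<inter> exponents e)). p - q \<in> rmod.span (range f))"
proof -
  let ?U = "rmod.span (range f) \<inter> forms e"
  have dU: "kvs.dim ?U = card (large_exponents UNIV e)" by (rule hilbert_function_initial) simp
  obtain D where D: "finite D" "D \<subseteq> forms e" "card D + kvs.dim ?U = kvs.dim (forms e :: ('v, 'k) mpoly set)"
    "\<And>w. w \<in> forms e \<Longrightarrow> \<exists>d\<in>kvs.span D. w - d \<in> ?U"
  proof (rule kvs.complement_basis[of ?U "forms e" "monomial ` exponents e"])
    show "kvs.subspace ?U"
      by (intro kvs.subspace_inter kvs_subspace_ideal rmod.subspace_span subspace_forms)
  qed (auto simp: finite_exponents intro: subsetD[OF forms_subset_span])
  have "exponents e = (box \<inter> exponents e) \<union> large_exponents UNIV e" by (auto simp: box_def not_less)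
  moreover have "card ((box \<inter> exponents e) \<union> large_exponents UNIV e) = card (box \<inter> exponents e) + card (large_exponents UNIV e)"
    by (intro card_Un_disjoint) (auto simp: finite_exponents box_def dest: leD)
  ultimately have "card D = card (box \<inter> exponents e)" using D(3) dU by (simp add: dim_forms)
  then obtain b where b: "bij_betw b (box \<inter> exponents e) D"
    using finite_same_card_bij[of "box \<inter> exponents e" D] D(1) finite_exponents by auto
  have im: "b ` (box \<inter> exponents e) = D" using b by (simp add: bij_betw_def)
  have "\<forall>t\<in>box \<inter> exponents e. homogeneous e (b t)" using im D(2) by (auto simp: forms_def)
  moreover have "\<forall>p\<in>forms e. \<exists>q\<in>kvs.span (b ` (box \<inter> exponents e)). p - q \<in> rmod.span (range f)"
    unfolding im using D(4) by blast
  ultimately show ?thesis by blast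
qed

end

section \<open>Extension of ideals to a free module\<close>

text \<open>
  More vectors than coordinates are linearly dependent over the domain \<open>A/q\<close>. This is fraction-free
  Gaussian elimination: the pivot row, indexed by \<open>i0\<close>, clears the coordinate \<open>x\<close> in all other rows.
\<close>

lemma dependence_modulo_prime:
  fixes q :: "'a::comm_ring_1 set" and t :: "'i \<Rightarrow> 'j \<Rightarrow> 'a"
  assumes q: "is_prime_ideal q" and "finite X" "finite Y" "card X < card Y"
  shows "\<exists>s. (\<exists>i\<in>Y. s i \<notin> q) \<and> (\<forall>k\<in>X. (\<Sum>i\<in>Y. s i * t i k) \<in> q)"
  using assms(2-4)
proof (induction X arbitrary: Y t rule: finite_induct)
  case empty
  then have "Y \<noteq> {}" by auto
  then show ?case using q by (intro exI[of _ "\<lambda>_. 1"]) (auto simp: is_prime_ideal_iff)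
next
  case (insert x X)
  have S: "rmod.subspace q" and qp: "\<And>a b. a * b \<in> q \<Longrightarrow> a \<in> q \<or> b \<in> q"
    using q by (auto simp: is_prime_ideal_iff)
  show ?case
  proof (cases "\<forall>i\<in>Y. t i x \<in> q")
    case True
    have "card X < card Y" using insert by simp
    from insert.IH[OF insert.prems(1) this, of t] obtain s where
      s: "\<exists>i\<in>Y. s i \<notin> q" "\<forall>k\<in>X. (\<Sum>i\<in>Y. s i * t i k) \<in> q" by blast
    moreover have "(\<Sum>i\<in>Y. s i * t i x) \<in> q"
      using True by (intro rmod.subspace_sum[OF S] rmod.subspace_scale[OF S]) blast
    ultimately show ?thesis by (intro exI[of _ s]) simp
  next
    case False
    then obtain i0 where i0: "i0 \<in> Y" "t i0 x \<notin> q" by blast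
    define c where "c = t i0 x"
    define t' where "t' i k = c * t i k - t i x * t i0 k" for i k
    let ?Y = "Y - {i0}"
    have "card X < card ?Y" using insert i0 by simp
    from insert.IH[OF _ this, of t'] obtain s' where
      s': "\<exists>i\<in>?Y. s' i \<notin> q" "\<forall>k\<in>X. (\<Sum>i\<in>?Y. s' i * t' i k) \<in> q" using insert.prems by auto
    define s where "s i = (if i = i0 then - (\<Sum>j\<in>?Y. s' j * t j x) else c * s' i)" for i
    have eq: "(\<Sum>i\<in>Y. s i * t i k) = (\<Sum>i\<in>?Y. s' i * t' i k)" for k
    proof -
      have "(\<Sum>i\<in>Y. s i * t i k) = s i0 * t i0 k + (\<Sum>i\<in>?Y. s i * t i k)"
        by (rule sum.remove[OF insert.prems(1) i0(1)])
      also have "(\<Sum>i\<in>?Y. s i * t i k) = (\<Sum>i\<in>?Y. c * s' i * t i k)"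
        by (intro sum.cong) (auto simp: s_def)
      also have "s i0 * t i0 k = - (\<Sum>i\<in>?Y. s' i * t i x * t i0 k)"
        by (simp add: s_def sum_distrib_right)
      finally show ?thesis
        by (simp add: t'_def right_diff_distrib sum_subtractf ac_simps)
    qed
    have "\<forall>k\<in>insert x X. (\<Sum>i\<in>Y. s i * t i k) \<in> q"
    proof
      fix k assume "k \<in> insert x X"
      then consider "k = x" | "k \<in> X" by blast
      then show "(\<Sum>i\<in>Y. s i * t i k) \<in> q"
      proof cases
        case 1
        then show ?thesis unfolding eq using rmod.subspace_0[OF S] by (simp add: t'_def c_def mult.commute)
      next
        case 2
        then show ?thesis unfolding eq using s'(2) by blast
      qed
    qed
    moreover have "\<exists>i\<in>Y. s i \<notin> q"
    proof -
      obtain i where i: "i \<in> ?Y" "s' i \<notin> q" using s'(1) by blast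
      then have "c * s' i \<notin> q" using qp i0(2) by (auto simp: c_def)
      then show ?thesis using i by (intro bexI[of _ i]) (auto simp: s_def)
    qed
    ultimately show ?thesis by blast
  qed
qed

lemma span_of_products:
  fixes X Y :: "'a::comm_ring_1 set"
  shows "rmod.span {a * b |a b. a \<in> rmod.span X \<and> b \<in> rmod.span Y} = rmod.span {x * y |x y. x \<in> X \<and> y \<in> Y}"
    (is "?A = ?B")
proof
  have 1: "x * b \<in> ?B" if "x \<in> X" "b \<in> rmod.span Y" for x b
    using that(2)
  proof (induction rule: rmod.span_induct_alt)
    case base
    show ?case by (simp add: rmod.span_zero)
  next
    case (step c y z)
    have "x * y \<in> ?B" using step(1) that(1) by (intro rmod.span_base) blast
    from rmod.span_add[OF rmod.span_scale[OF this] step(2)] have "c * (x * y) + x * z \<in> ?B" .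
    then show ?case by (simp add: algebra_simps)
  qed
  have 2: "a * b \<in> ?B" if "a \<in> rmod.span X" "b \<in> rmod.span Y" for a b
    using that(1)
  proof (induction rule: rmod.span_induct_alt)
    case base
    show ?case by (simp add: rmod.span_zero)
  next
    case (step c x z)
    from rmod.span_add[OF rmod.span_scale[OF 1[OF step(1) that(2)]] step(2)]
    have "c * (x * b) + z * b \<in> ?B" .
    then show ?case by (simp add: algebra_simps)
  qed
  show "?A \<subseteq> ?B" by (rule rmod.span_minimal) (use 2 in auto)
  show "?B \<subseteq> ?A"
  proof (rule rmod.span_mono, rule subsetI)
    fix z assume "z \<in> {x * y |x y. x \<in> X \<and> y \<in> Y}"
    then obtain x y where "z = x * y" "x \<in> X" "y \<in> Y" by blast
    then show "z \<in> {a * b |a b. a \<in> rmod.span X \<and> b \<in> rmod.span Y}"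
      using rmod.span_base[of x X] rmod.span_base[of y Y] by blast
  qed
qed

text \<open>
  Along such a homomorphism, \<open>extended_ideal L\<close> is the ideal \<open>\<phi>\<^sub>*(L)\<close>, and \<open>\<phi> -` Q\<close> is the contraction.
\<close>

locale unital_ring_hom =
  fixes \<phi> :: "'a::comm_ring_1 \<Rightarrow> 'b::comm_ring_1"
  assumes hom_add: "\<phi> (x + y) = \<phi> x + \<phi> y"
    and hom_mult: "\<phi> (x * y) = \<phi> x * \<phi> y"
    and hom_1: "\<phi> 1 = 1"
begin

lemma hom_0: "\<phi> 0 = 0"
  using hom_add[of 0 0] by simp

lemma hom_sum: "\<phi> (sum g A) = (\<Sum>x\<in>A. \<phi> (g x))"
  by (induction A rule: infinite_finite_induct) (simp_all add: hom_0 hom_add)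

lemma hom_power: "\<phi> (x ^ n) = \<phi> x ^ n"
  by (induction n) (simp_all add: hom_1 hom_mult)

definition extended_ideal :: "'a set \<Rightarrow> 'b set" where
  "extended_ideal L = rmod.span (\<phi> ` L)"

lemma subspace_ext: "rmod.subspace (extended_ideal L)"
  by (simp add: extended_ideal_def)

lemma ext_span: "extended_ideal (rmod.span G) = rmod.span (\<phi> ` G)"
proof
  have "\<phi> x \<in> rmod.span (\<phi> ` G)" if "x \<in> rmod.span G" for x
    using that
  proof (induction rule: rmod.span_induct_alt)
    case base
    show ?case by (simp add: hom_0 rmod.span_zero)
  next
    case (step c x y)
    then show ?case
      by (auto simp: hom_add hom_mult intro!: rmod.span_add rmod.span_scale intro: rmod.span_base)
  qed
  then show "extended_ideal (rmod.span G) \<subseteq> rmod.span (\<phi> ` G)"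
    unfolding extended_ideal_def by (intro rmod.span_minimal) auto
  show "rmod.span (\<phi> ` G) \<subseteq> extended_ideal (rmod.span G)"
    unfolding extended_ideal_def by (intro rmod.span_mono image_mono rmod.span_superset)
qed

lemma ext_ideal_power:
  assumes "rmod.subspace J"
  shows "ideal_power (extended_ideal J) m = extended_ideal (ideal_power J m)"
proof (induction m)
  case 0
  have "1 \<in> extended_ideal UNIV" unfolding extended_ideal_def by (rule rmod.span_base) (use hom_1 in \<open>force\<close>)
  then have "extended_ideal UNIV = UNIV" using UNIV_eq_if_one_mem[OF subspace_ext] by blast
  then show ?case by (simp add: ideal_power_0)
next
  case (Suc m)
  have "ideal_power (extended_ideal J) (Suc m)
      = rmod.span {a * b |a b. a \<in> rmod.span (\<phi> ` ideal_power J m) \<and> b \<in> rmod.span (\<phi> ` J)}"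
    by (simp add: ideal_power_Suc_span[OF subspace_ext] Suc) (simp add: extended_ideal_def)
  also have "\<dots> = rmod.span {x * y |x y. x \<in> \<phi> ` ideal_power J m \<and> y \<in> \<phi> ` J}"
    by (rule span_of_products)
  also have "{x * y |x y. x \<in> \<phi> ` ideal_power J m \<and> y \<in> \<phi> ` J}
      = \<phi> ` {a * b |a b. a \<in> ideal_power J m \<and> b \<in> J}"
  proof (intro equalityI subsetI)
    fix z assume "z \<in> {x * y |x y. x \<in> \<phi> ` ideal_power J m \<and> y \<in> \<phi> ` J}"
    then obtain a b where "z = \<phi> (a * b)" "a \<in> ideal_power J m" "b \<in> J"
      by (auto simp: hom_mult)
    then show "z \<in> \<phi> ` {a * b |a b. a \<in> ideal_power J m \<and> b \<in> J}" by blast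
  qed (force simp: hom_mult)
  also have "rmod.span \<dots> = extended_ideal (ideal_power J (Suc m))"
    by (simp add: ideal_power_Suc_span[OF assms] ext_span)
  finally show ?case .
qed

lemma prime_vimage: "is_prime_ideal Q \<Longrightarrow> is_prime_ideal (\<phi> -` Q)"
  by (auto simp: is_prime_ideal_iff hom_1 hom_mult hom_add hom_0 rmod.subspace_0 rmod.subspace_add
      rmod.subspace_scale intro!: rmod.subspaceI)

lemma ext_subset_iff:
  assumes "rmod.subspace Q"
  shows "extended_ideal L \<subseteq> Q \<longleftrightarrow> L \<subseteq> \<phi> -` Q"
proof
  assume "extended_ideal L \<subseteq> Q"
  then show "L \<subseteq> \<phi> -` Q" using rmod.span_superset[of "\<phi> ` L"] by (auto simp: extended_ideal_def)
next
  assume "L \<subseteq> \<phi> -` Q"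
  then have "\<phi> ` L \<subseteq> Q" by blast
  then show "extended_ideal L \<subseteq> Q" unfolding extended_ideal_def by (rule rmod.span_minimal) fact
qed

end

text \<open>
  The ring \<open>'b\<close> is a free module over \<open>'a\<close> with the finite nonempty basis \<open>b\<close>.
\<close>

locale free_extension = unital_ring_hom \<phi> for \<phi> :: "'a::comm_ring_1 \<Rightarrow> 'b::comm_ring_1" +
  fixes B :: "'i set" and b :: "'i \<Rightarrow> 'b"
  assumes finite_B: "finite B" and nonempty_B: "B \<noteq> {}"
    and spanning: "\<exists>s. x = (\<Sum>\<beta>\<in>B. \<phi> (s \<beta>) * b \<beta>)"
    and independent: "(\<Sum>\<beta>\<in>B. \<phi> (s \<beta>) * b \<beta>) = 0 \<Longrightarrow> \<beta> \<in> B \<Longrightarrow> s \<beta> = 0"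
begin

definition combine :: "('i \<Rightarrow> 'a) \<Rightarrow> 'b" where
  "combine s = (\<Sum>\<beta>\<in>B. \<phi> (s \<beta>) * b \<beta>)"

lemma combine_surj: obtains s where "x = combine s"
  using spanning[of x] unfolding combine_def by blast

lemma combine_add: "combine (\<lambda>\<beta>. s \<beta> + t \<beta>) = combine s + combine t"
  by (simp add: combine_def hom_add distrib_right sum.distrib)

lemma combine_scale: "\<phi> x * combine s = combine (\<lambda>\<beta>. x * s \<beta>)"
  by (simp add: combine_def hom_mult sum_distrib_left mult.assoc)

lemma combine_sum: "(\<Sum>i\<in>X. \<phi> (c i) * combine (t i)) = combine (\<lambda>\<beta>. \<Sum>i\<in>X. c i * t i \<beta>)"
proof -
  have "(\<Sum>i\<in>X. \<phi> (c i) * combine (t i)) = (\<Sum>i\<in>X. \<Sum>\<beta>\<in>B. \<phi> (c i * t i \<beta>) * b \<beta>)"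
    unfolding combine_scale by (simp add: combine_def)
  also have "\<dots> = (\<Sum>\<beta>\<in>B. \<Sum>i\<in>X. \<phi> (c i * t i \<beta>) * b \<beta>)" by (rule sum.swap)
  finally show ?thesis by (simp add: combine_def hom_sum sum_distrib_right)
qed

lemma combine_inject:
  assumes "combine s = combine t" "\<beta> \<in> B" shows "s \<beta> = t \<beta>"
proof -
  have "combine (\<lambda>\<beta>. s \<beta> + (- 1) * t \<beta>) = combine s + \<phi> (- 1) * combine t"
    unfolding combine_add combine_scale ..
  also have "\<dots> = \<phi> (1 + (- 1)) * combine t" by (simp only: assms(1) hom_add hom_1 distrib_right mult_1)
  also have "\<dots> = 0" by (simp add: hom_0)
  finally show ?thesis using independent[of "\<lambda>\<beta>. s \<beta> + (- 1) * t \<beta>" \<beta>] assms(2) by (simp add: combine_def)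
qed

text \<open>
  The elements on the right form an ideal of the larger ring: multiplying by \<open>c\<close> acts on coordinates
  through a matrix over the smaller ring, and \<open>L\<close> is an ideal there. It contains \<open>\<phi> l\<close> because the
  coordinates of \<open>\<phi> l\<close> are \<open>l\<close> times those of \<open>1\<close>.
\<close>

lemma ext_eq:
  assumes L: "rmod.subspace L"
  shows "extended_ideal L = {combine s |s. \<forall>\<beta>\<in>B. s \<beta> \<in> L}" (is "_ = ?R")
proof
  have "rmod.subspace ?R"
  proof (rule rmod.subspaceI)
    have "0 = combine (\<lambda>_. 0)" by (simp add: combine_def hom_0)
    then show "0 \<in> ?R" using rmod.subspace_0[OF L] by blast
  next
    fix x y assume "x \<in> ?R" "y \<in> ?R"
    then obtain s t where "x = combine s" "y = combine t" "\<forall>\<beta>\<in>B. s \<beta> \<in> L" "\<forall>\<beta>\<in>B. t \<beta> \<in> L" by blast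
    then show "x + y \<in> ?R" using rmod.subspace_add[OF L]
      by (intro CollectI exI[of _ "\<lambda>\<beta>. s \<beta> + t \<beta>"]) (simp add: combine_add)
  next
    fix c x assume "x \<in> ?R"
    then obtain s where s: "x = combine s" "\<forall>\<beta>\<in>B. s \<beta> \<in> L" by blast
    have "\<exists>t. \<forall>\<beta>. c * b \<beta> = combine (t \<beta>)" using combine_surj by (intro choice allI) blast
    then obtain t where t: "\<And>\<beta>. c * b \<beta> = combine (t \<beta>)" by blast
    have "c * x = (\<Sum>\<beta>\<in>B. \<phi> (s \<beta>) * (c * b \<beta>))"
      by (simp add: s(1) combine_def sum_distrib_left mult.left_commute)
    also have "\<dots> = combine (\<lambda>\<gamma>. \<Sum>\<beta>\<in>B. s \<beta> * t \<beta> \<gamma>)" by (simp only: t combine_sum)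
    finally have "c * x = combine (\<lambda>\<gamma>. \<Sum>\<beta>\<in>B. s \<beta> * t \<beta> \<gamma>)" .
    moreover have "(\<Sum>\<beta>\<in>B. s \<beta> * t \<beta> \<gamma>) \<in> L" for \<gamma>
    proof (rule rmod.subspace_sum[OF L])
      fix \<beta> assume "\<beta> \<in> B"
      then show "s \<beta> * t \<beta> \<gamma> \<in> L"
        using rmod.subspace_scale[OF L, of "s \<beta>" "t \<beta> \<gamma>"] s(2) by (simp add: mult.commute)
    qed
    ultimately show "c * x \<in> ?R" by blast
  qed
  moreover have "\<phi> ` L \<subseteq> ?R"
  proof
    fix y assume "y \<in> \<phi> ` L"
    then obtain l where l: "l \<in> L" "y = \<phi> l" by blast
    obtain s where s: "1 = combine s" by (rule combine_surj)
    have "y = combine (\<lambda>\<beta>. l * s \<beta>)" unfolding l(2) by (simp flip: combine_scale s)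
    moreover have "l * s \<beta> \<in> L" for \<beta>
      using rmod.subspace_scale[OF L l(1), of "s \<beta>"] by (simp add: mult.commute)
    ultimately show "y \<in> ?R" by blast
  qed
  ultimately show "extended_ideal L \<subseteq> ?R" unfolding extended_ideal_def by (rule rmod.span_minimal[rotated])
  show "?R \<subseteq> extended_ideal L"
  proof
    fix x assume "x \<in> ?R"
    then obtain s where s: "x = combine s" "\<forall>\<beta>\<in>B. s \<beta> \<in> L" by blast
    have "b \<beta> * \<phi> (s \<beta>) \<in> extended_ideal L" if "\<beta> \<in> B" for \<beta>
      unfolding extended_ideal_def using s(2) that by (intro rmod.span_scale rmod.span_base) blast
    then have "\<phi> (s \<beta>) * b \<beta> \<in> extended_ideal L" if "\<beta> \<in> B" for \<beta> using that by (simp add: mult.commute)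
    then show "x \<in> extended_ideal L" unfolding s(1) combine_def by (rule rmod.subspace_sum[OF subspace_ext])
  qed
qed

lemma combine_mem_ext_iff:
  assumes "rmod.subspace L"
  shows "combine s \<in> extended_ideal L \<longleftrightarrow> (\<forall>\<beta>\<in>B. s \<beta> \<in> L)"
proof
  assume "combine s \<in> extended_ideal L"
  then obtain t where t: "combine s = combine t" "\<forall>\<beta>\<in>B. t \<beta> \<in> L" unfolding ext_eq[OF assms] by blast
  show "\<forall>\<beta>\<in>B. s \<beta> \<in> L"
  proof
    fix \<beta> assume "\<beta> \<in> B"
    then show "s \<beta> \<in> L" using combine_inject[OF t(1)] t(2) by simp
  qed
next
  assume "\<forall>\<beta>\<in>B. s \<beta> \<in> L"
  then show "combine s \<in> extended_ideal L" unfolding ext_eq[OF assms] by blast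
qed

text \<open>
  Faithfulness: test with the element all of whose coordinates are equal to a given \<open>x \<in> L\<close>.
\<close>

lemma ext_subset_ext_iff:
  assumes L: "rmod.subspace L" and M: "rmod.subspace M"
  shows "extended_ideal L \<subseteq> extended_ideal M \<longleftrightarrow> L \<subseteq> M"
proof
  assume sub: "extended_ideal L \<subseteq> extended_ideal M"
  show "L \<subseteq> M"
  proof
    fix x assume "x \<in> L"
    then have "combine (\<lambda>_. x) \<in> extended_ideal L" using combine_mem_ext_iff[OF L] by blast
    then have "combine (\<lambda>_. x) \<in> extended_ideal M" using sub by blast
    then show "x \<in> M" using combine_mem_ext_iff[OF M, of "\<lambda>_. x"] nonempty_B by auto
  qed
next
  assume "L \<subseteq> M"
  then show "extended_ideal L \<subseteq> extended_ideal M" unfolding extended_ideal_def by (intro rmod.span_mono image_mono)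
qed

text \<open>
  Suppose \<open>x \<in> Q - P\<close>. One more power of \<open>x\<close> than the rank must satisfy a relation modulo \<open>P\<close> with
  coefficients in the smaller ring that are not all in the common contraction \<open>q\<close>. Working up from the
  constant term, \<open>x \<notin> P\<close> allows division by powers of \<open>x\<close>, and \<open>x \<in> Q\<close> then puts each coefficient into
  \<open>Q\<close>, so into \<open>q\<close>; a contradiction.
\<close>

lemma prime_incomparable:
  assumes P: "is_prime_ideal P" and Q: "is_prime_ideal Q" and PQ: "P \<subseteq> Q"
    and contr: "\<phi> -` P = \<phi> -` Q"
  shows "P = Q"
proof (rule ccontr)
  assume "P \<noteq> Q"
  then obtain x where x: "x \<in> Q" "x \<notin> P" using PQ by blast
  have SP: "rmod.subspace P" and SQ: "rmod.subspace Q"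
    and Pp: "\<And>u v. u * v \<in> P \<Longrightarrow> u \<in> P \<or> v \<in> P" using P Q by (auto simp: is_prime_ideal_iff)
  define q where "q = \<phi> -` P"
  have q: "is_prime_ideal q" unfolding q_def by (rule prime_vimage[OF P])
  have Sq: "rmod.subspace q" using q by (simp add: is_prime_ideal_iff)
  have "\<exists>t. \<forall>i. x ^ i = combine (t i)" using combine_surj by (intro choice allI) blast
  then obtain t where t: "\<And>i. x ^ i = combine (t i)" by blast
  let ?N = "card B"
  from dependence_modulo_prime[OF q finite_B, of "{..?N}" t] obtain s where
    s: "\<exists>i\<in>{..?N}. s i \<notin> q" "\<forall>k\<in>B. (\<Sum>i\<in>{..?N}. s i * t i k) \<in> q" by auto
  have "(\<Sum>i\<le>?N. \<phi> (s i) * x ^ i) \<in> extended_ideal q"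
    unfolding t combine_sum combine_mem_ext_iff[OF Sq] by (rule s(2))
  moreover have "extended_ideal q \<subseteq> P" unfolding ext_subset_iff[OF SP] by (simp add: q_def)
  ultimately have rel: "(\<Sum>i\<le>?N. \<phi> (s i) * x ^ i) \<in> P" by blast
  have "\<phi> (s j) \<in> P" if "j \<le> ?N" for j
    using that
  proof (induction j rule: less_induct)
    case (less j)
    let ?w = "\<Sum>i\<in>{Suc j..?N}. \<phi> (s i) * x ^ (i - Suc j)"
    have low: "(\<Sum>i<j. \<phi> (s i) * x ^ i) \<in> P"
    proof (rule rmod.subspace_sum[OF SP])
      fix i assume "i \<in> {..<j}"
      then have "\<phi> (s i) \<in> P" using less by simp
      then show "\<phi> (s i) * x ^ i \<in> P"
        using rmod.subspace_scale[OF SP, of "\<phi> (s i)" "x ^ i"] by (simp add: mult.commute)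
    qed
    have "{..?N} = {..<j} \<union> insert j {Suc j..?N}" using less.prems by auto
    then have "(\<Sum>i\<le>?N. \<phi> (s i) * x ^ i)
        = (\<Sum>i<j. \<phi> (s i) * x ^ i) + (\<Sum>i\<in>insert j {Suc j..?N}. \<phi> (s i) * x ^ i)"
      by (simp only:) (rule sum.union_disjoint; auto)
    also have "(\<Sum>i\<in>insert j {Suc j..?N}. \<phi> (s i) * x ^ i)
        = \<phi> (s j) * x ^ j + (\<Sum>i\<in>{Suc j..?N}. \<phi> (s i) * x ^ i)"
      by (rule sum.insert) auto
    also have "(\<Sum>i\<in>{Suc j..?N}. \<phi> (s i) * x ^ i) = x ^ j * (x * ?w)"
      unfolding sum_distrib_left
    proof (intro sum.cong refl)
      fix i assume "i \<in> {Suc j..?N}"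
      then have "x ^ i = x ^ (j + Suc (i - Suc j))" by simp
      then have "x ^ i = x ^ j * (x * x ^ (i - Suc j))" by (simp only: power_add power_Suc)
      then show "\<phi> (s i) * x ^ i = x ^ j * (x * (\<phi> (s i) * x ^ (i - Suc j)))" by (simp only: ac_simps)
    qed
    finally have "(\<Sum>i\<le>?N. \<phi> (s i) * x ^ i) - (\<Sum>i<j. \<phi> (s i) * x ^ i) = x ^ j * (\<phi> (s j) + x * ?w)"
      by (simp add: algebra_simps)
    then have "x ^ j * (\<phi> (s j) + x * ?w) \<in> P" using rmod.subspace_diff[OF SP rel low] by simp
    then have "\<phi> (s j) + x * ?w \<in> P" using Pp prime_power_mem[OF P] x(2) by blast
    then have 1: "\<phi> (s j) + x * ?w \<in> Q" using PQ by blast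
    have 2: "?w * x \<in> Q" by (rule rmod.subspace_scale[OF SQ x(1)])
    have "\<phi> (s j) \<in> Q" using rmod.subspace_diff[OF SQ 1 2] by (simp add: mult.commute)
    then have "s j \<in> \<phi> -` P" unfolding contr by simp
    then show ?case by simp
  qed
  then show False using s(1) by (auto simp: q_def)
qed

end

section \<open>Substituting a regular sequence is free\<close>

locale regular_substitution = regular_forms f d + unital_ring_hom \<phi>
  for f :: "'v::{finite,linorder} \<Rightarrow> ('v, 'k::field) mpoly" and d :: nat
    and \<phi> :: "('v, 'k) mpoly \<Rightarrow> ('v, 'k) mpoly" +
  assumes hom_Const: "\<phi> (Const c) = Const c" and hom_Var: "\<phi> (Var i) = f i"
begin

lemma hom_single: "\<phi> (Poly_Mapping.single t c) = Const c * \<phi> (monomial t)"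
  by (simp add: single_eq_Const_monomial hom_mult hom_Const)

lemma hom_monomial_single: "\<phi> (monomial (Poly_Mapping.single i 1)) = f i"
  using hom_Var[of i] by (simp only: Var_eq_monomial)

lemma homogeneous_hom_monomial: "homogeneous (d * total_degree t) (\<phi> (monomial t))"
proof (induction "total_degree t" arbitrary: t)
  case 0
  then have "t = 0" by simp
  then show ?case by (simp add: hom_1 homogeneous_def)
next
  case (Suc n)
  then have "t \<noteq> 0" by auto
  then obtain i where i: "Poly_Mapping.lookup t i \<noteq> 0" by (auto simp: poly_mapping_eq_iff fun_eq_iff)
  define s where "s = t - Poly_Mapping.single i 1"
  have t: "t = Poly_Mapping.single i 1 + s"
    unfolding s_def using i
    by (intro poly_mapping_eqI) (auto simp: lookup_add lookup_minus lookup_single when_def)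
  have "homogeneous (d * total_degree s) (\<phi> (monomial s))" using Suc.hyps by (simp add: t)
  from homogeneous_mult[OF homog this, of i] show ?case
    unfolding t monomial_add hom_mult hom_monomial_single by simp
qed

lemma degree_part_hom: "degree_part e (\<phi> p) = (if d dvd e then \<phi> (degree_part (e div d) p) else 0)"
proof (induction p rule: mpoly_induct)
  case zero
  show ?case by (simp add: hom_0)
next
  case (single t c)
  have "homogeneous (0 + d * total_degree t) (\<phi> (Poly_Mapping.single t c))"
    unfolding hom_single by (intro homogeneous_mult homogeneous_Const homogeneous_hom_monomial)
  then have "homogeneous (d * total_degree t) (\<phi> (Poly_Mapping.single t c))" by simp
  then show ?case using d_pos by (auto simp: degree_part_of_homogeneous degree_part_single hom_0)
qed (simp add: hom_add degree_part_add)

text \<open>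
  The lifted bases of the graded pieces, collected into a single family indexed by the box.
\<close>

definition box_complement :: "(('v \<Rightarrow>\<^sub>0 nat) \<Rightarrow> ('v, 'k) mpoly) \<Rightarrow> bool" where
  "box_complement b \<longleftrightarrow> (\<forall>t\<in>box. homogeneous (total_degree t) (b t)) \<and>
    (\<forall>e. \<forall>p\<in>forms e. \<exists>q\<in>kvs.span (b ` (box \<inter> exponents e)). p - q \<in> rmod.span (range f))"

lemma box_complement_exists: "\<exists>b. box_complement b"
proof -
  have "\<exists>b. \<forall>e. (\<forall>t\<in>box \<inter> exponents e. homogeneous e (b e t)) \<and>
    (\<forall>p\<in>forms e. \<exists>q\<in>kvs.span (b e ` (box \<inter> exponents e)). p - q \<in> rmod.span (range f))"
    using complement_of_span_f by (intro choice allI)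
  then obtain b where b: "\<And>e. \<forall>t\<in>box \<inter> exponents e. homogeneous e (b e t)"
    "\<And>e. \<forall>p\<in>forms e. \<exists>q\<in>kvs.span (b e ` (box \<inter> exponents e)). p - q \<in> rmod.span (range f)" by blast
  have "(\<lambda>t. b (total_degree t) t) ` (box \<inter> exponents e) = b e ` (box \<inter> exponents e)" for e
    by (intro image_cong) (auto simp: exponents_def)
  then have "box_complement (\<lambda>t. b (total_degree t) t)"
    unfolding box_complement_def using b by (auto simp: exponents_def)
  then show ?thesis by blast
qed

text \<open>
  The indices of those products \<open>\<phi>(y\<^sup>\<alpha>) b\<^sub>\<beta>\<close> that have degree \<open>e\<close>.
\<close>

definition product_index :: "nat \<Rightarrow> (('v \<Rightarrow>\<^sub>0 nat) \<times> ('v \<Rightarrow>\<^sub>0 nat)) set" where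
  "product_index e = (SIGMA \<beta>:box. {\<alpha>. d * total_degree \<alpha> + total_degree \<beta> = e})"

lemma finite_cofactors: "finite {\<alpha> :: 'v \<Rightarrow>\<^sub>0 nat. d * total_degree \<alpha> + n = e}"
proof (rule finite_subset[OF _ finite_exponents_bounded[of e]], rule subsetI, rule CollectI, rule allI)
  fix \<alpha> :: "'v \<Rightarrow>\<^sub>0 nat" and i
  assume "\<alpha> \<in> {\<alpha>. d * total_degree \<alpha> + n = e}"
  then have "d * total_degree \<alpha> \<le> e" by simp
  moreover have "total_degree \<alpha> \<le> d * total_degree \<alpha>" using d_pos by simp
  ultimately show "Poly_Mapping.lookup \<alpha> i \<le> e" using lookup_le_tdeg[of \<alpha> i] by linarith
qed

lemma finite_product_index: "finite (product_index e)"
  unfolding product_index_def using finite_box finite_cofactors by (intro finite_SigmaI)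

text \<open>
  Division with remainder by \<open>d\<close> in each exponent recovers \<open>(\<beta>, \<alpha>)\<close> from the monomial \<open>y\<^bsup>d\<alpha>+\<beta>\<^esup>\<close>. The inequality is
  enough, since the products span.
\<close>

lemma card_product_index: "card (product_index e) \<le> card (exponents e :: ('v \<Rightarrow>\<^sub>0 nat) set)"
proof (rule card_inj_on_le[OF _ _ finite_exponents])
  let ?h = "\<lambda>(\<beta>, \<alpha>). Poly_Mapping.map ((*) d) \<alpha> + (\<beta> :: 'v \<Rightarrow>\<^sub>0 nat)"
  have lookup_h: "Poly_Mapping.lookup (?h (\<beta>, \<alpha>)) i = d * Poly_Mapping.lookup \<alpha> i + Poly_Mapping.lookup \<beta> i"
    for \<alpha> \<beta> i
    by (simp add: lookup_add Poly_Mapping.map.rep_eq when_def)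
  show "inj_on ?h (product_index e)"
  proof (rule inj_onI)
    fix x y assume x: "x \<in> product_index e" and y: "y \<in> product_index e" and eq: "?h x = ?h y"
    obtain \<beta> \<alpha> \<beta>' \<alpha>' where xy: "x = (\<beta>, \<alpha>)" "y = (\<beta>', \<alpha>')" by (cases x, cases y)
    have lt: "Poly_Mapping.lookup \<beta> i < d" "Poly_Mapping.lookup \<beta>' i < d" for i
      using x y by (auto simp: xy product_index_def box_def)
    have l: "d * Poly_Mapping.lookup \<alpha> i + Poly_Mapping.lookup \<beta> i
        = d * Poly_Mapping.lookup \<alpha>' i + Poly_Mapping.lookup \<beta>' i" for i
      using lookup_h[of \<beta> \<alpha> i] lookup_h[of \<beta>' \<alpha>' i] eq by (simp add: xy)
    have "Poly_Mapping.lookup \<beta> i = Poly_Mapping.lookup \<beta>' i" for i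
      using arg_cong[OF l[of i], of "\<lambda>n. n mod d"] lt[of i] by simp
    moreover have "Poly_Mapping.lookup \<alpha> i = Poly_Mapping.lookup \<alpha>' i" for i
      using arg_cong[OF l[of i], of "\<lambda>n. n div d"] lt[of i] by simp
    ultimately show "x = y" unfolding xy by (simp add: poly_mapping_eqI)
  qed
  show "?h ` product_index e \<subseteq> exponents e"
  proof
    fix u assume "u \<in> ?h ` product_index e"
    then obtain \<beta> \<alpha> where u: "u = ?h (\<beta>, \<alpha>)" "d * total_degree \<alpha> + total_degree \<beta> = e"
      by (auto simp: product_index_def)
    have "total_degree u = d * total_degree \<alpha> + total_degree \<beta>"
      unfolding u(1) total_degree_def lookup_h by (simp add: sum.distrib sum_distrib_left)
    then show "u \<in> exponents e" using u(2) by (simp add: exponents_def)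
  qed
qed

text \<open>
  Graded Nakayama: modulo the span of the \<open>b\<^sub>\<beta>\<close>, a form of degree \<open>e\<close> is a combination of the \<open>f\<^sub>i\<close> with
  coefficients of the smaller degree \<open>e - d\<close>, and multiplying a product by \<open>f\<^sub>i\<close> yields another
  product.
\<close>

lemma forms_subset_span_products:
  assumes b: "box_complement b"
  shows "forms e \<subseteq> kvs.span ((\<lambda>(\<beta>, \<alpha>). \<phi> (monomial \<alpha>) * b \<beta>) ` product_index e)"
proof (induction e rule: less_induct)
  case (less e)
  let ?g = "\<lambda>(\<beta>, \<alpha>). \<phi> (monomial \<alpha>) * b \<beta>"
  let ?V = "\<lambda>e. kvs.span (?g ` product_index e)"
  have mult_f: "p * f i \<in> ?V e" if "p \<in> ?V (e - d)" "d \<le> e" for p i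
    using that(1)
  proof (induction rule: kvs.span_induct_alt)
    case base
    show ?case by (simp add: kvs.span_zero)
  next
    case (step c x y)
    then obtain \<beta> \<alpha> where x: "x = \<phi> (monomial \<alpha>) * b \<beta>" "(\<beta>, \<alpha>) \<in> product_index (e - d)" by auto
    have "x * f i = ?g (\<beta>, Poly_Mapping.single i 1 + \<alpha>)"
      by (simp only: x(1) monomial_add hom_mult hom_monomial_single prod.case ac_simps)
    moreover have "(\<beta>, Poly_Mapping.single i 1 + \<alpha>) \<in> product_index e"
      using x(2) that(2) by (auto simp: product_index_def)
    ultimately have "x * f i \<in> ?g ` product_index e" by (rule image_eqI)
    from kvs.span_add[OF kvs.span_scale[OF kvs.span_base[OF this]] step(2)]
    have "Const c * (x * f i) + y * f i \<in> ?V e" .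
    then show ?case by (simp add: algebra_simps)
  qed
  have high: "degree_part e x \<in> ?V e" if "x \<in> rmod.span (range f)" for x
    using that
  proof (induction rule: rmod.span_induct_alt)
    case base
    show ?case by (simp add: kvs.span_zero)
  next
    case (step c x y)
    then obtain i where i: "x = f i" by blast
    have "degree_part e (c * x) \<in> ?V e"
    proof (cases "d \<le> e")
      case True
      have "degree_part (e - d) c \<in> forms (e - d)" by (simp add: forms_def homogeneous_degree_part)
      then have "degree_part (e - d) c \<in> ?V (e - d)" using less[of "e - d"] d_pos True by auto
      from mult_f[OF this True] show ?thesis
        using True by (simp add: i degree_part_mult_homogeneous[OF homog])
    qed (simp add: i degree_part_mult_homogeneous[OF homog] kvs.span_zero)
    then show ?case using step(2) by (simp only: degree_part_add) (rule kvs.span_add)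
  qed
  show ?case
  proof
    fix p assume p: "p \<in> (forms e :: ('v, 'k) mpoly set)"
    then obtain q where q: "q \<in> kvs.span (b ` (box \<inter> exponents e))" "p - q \<in> rmod.span (range f)"
      using b unfolding box_complement_def by blast
    have "b ` (box \<inter> exponents e) \<subseteq> forms e"
      using b by (auto simp: box_complement_def forms_def exponents_def)
    then have "q \<in> forms e" using kvs.span_minimal[OF _ subspace_forms] q(1) by blast
    then have "p - q \<in> forms e" using kvs.subspace_diff[OF subspace_forms p] by blast
    then have "degree_part e (p - q) = p - q" by (simp add: forms_def homogeneous_iff_degree_part)
    then have 1: "p - q \<in> ?V e" using high[OF q(2)] by simp
    have "b ` (box \<inter> exponents e) \<subseteq> ?g ` product_index e"
    proof
      fix y assume "y \<in> b ` (box \<inter> exponents e)"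
      then obtain \<beta> where "\<beta> \<in> box" "total_degree \<beta> = e" "y = b \<beta>" by (auto simp: exponents_def)
      then show "y \<in> ?g ` product_index e"
        by (intro image_eqI[of _ _ "(\<beta>, 0)"]) (auto simp: product_index_def hom_1)
    qed
    then have 2: "q \<in> ?V e" using q(1) kvs.span_mono by blast
    show "p \<in> ?V e" using kvs.span_add[OF 1 2] by simp
  qed
qed

lemma degree_part_product:
  assumes "homogeneous n h"
  shows "degree_part e (\<phi> p * h) = (\<Sum>\<alpha>\<in>{\<alpha>. d * total_degree \<alpha> + n = e}. Const (Poly_Mapping.lookup p \<alpha>) * (\<phi> (monomial \<alpha>) * h))"
proof (induction p rule: mpoly_induct)
  case zero
  show ?case by (simp add: hom_0 Const_def)
next
  case (single t c)
  have "homogeneous (0 + (d * total_degree t + n)) (Const c * (\<phi> (monomial t) * h))"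
    by (intro homogeneous_mult homogeneous_Const homogeneous_hom_monomial assms)
  then have "degree_part e (\<phi> (Poly_Mapping.single t c) * h)
      = (if d * total_degree t + n = e then Const c * (\<phi> (monomial t) * h) else 0)"
    by (auto simp: hom_single mult.assoc degree_part_of_homogeneous)
  also have "\<dots> = (\<Sum>\<alpha>\<in>{\<alpha>. d * total_degree \<alpha> + n = e}. if \<alpha> = t then Const c * (\<phi> (monomial t) * h) else 0)"
    by (simp add: finite_cofactors)
  also have "\<dots> = (\<Sum>\<alpha>\<in>{\<alpha>. d * total_degree \<alpha> + n = e}.
      Const (Poly_Mapping.lookup (Poly_Mapping.single t c) \<alpha>) * (\<phi> (monomial \<alpha>) * h))"
    by (intro sum.cong) (auto simp: lookup_single when_def Const_def)
  finally show ?case .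
next
  case (add p q)
  have "Const (x + y) = Const x + (Const y :: ('v, 'k) mpoly)" for x y
    by (simp add: Const_def single_add)
  with add show ?case by (simp add: hom_add distrib_right degree_part_add lookup_add sum.distrib)
qed

text \<open>
  Both parts can be checked one degree at a time: spanning is the preceding lemma, and independence
  follows because in each degree the number of products is at most the dimension that they span.
\<close>

theorem free_over_image:
  obtains b where "free_extension \<phi> box b"
proof -
  obtain b where b: "box_complement b" using box_complement_exists by blast
  let ?g = "\<lambda>(\<beta>, \<alpha>). \<phi> (monomial \<alpha>) * b \<beta>"
  have hb: "homogeneous (total_degree \<beta>) (b \<beta>)" if "\<beta> \<in> box" for \<beta>
    using b that by (simp add: box_complement_def)
  let ?C = "range (\<lambda>s. \<Sum>\<beta>\<in>box. \<phi> (s \<beta>) * b \<beta>)"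
  have sC: "kvs.subspace ?C"
  proof (rule kvs.subspaceI)
    show "0 \<in> ?C" by (rule range_eqI[of _ _ "\<lambda>_. 0"]) (simp add: hom_0)
  next
    fix x y assume "x \<in> ?C" "y \<in> ?C"
    then obtain s t where "x = (\<Sum>\<beta>\<in>box. \<phi> (s \<beta>) * b \<beta>)" "y = (\<Sum>\<beta>\<in>box. \<phi> (t \<beta>) * b \<beta>)" by blast
    then show "x + y \<in> ?C"
      by (intro range_eqI[of _ _ "\<lambda>\<beta>. s \<beta> + t \<beta>"]) (simp add: hom_add distrib_right sum.distrib)
  next
    fix c x assume "x \<in> ?C"
    then obtain s where "x = (\<Sum>\<beta>\<in>box. \<phi> (s \<beta>) * b \<beta>)" by blast
    then show "Const c * x \<in> ?C"
      by (intro range_eqI[of _ _ "\<lambda>\<beta>. Const c * s \<beta>"])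
        (simp add: hom_mult hom_Const sum_distrib_left mult.assoc)
  qed
  have "?g ` product_index e \<subseteq> ?C" for e
  proof
    fix x assume "x \<in> ?g ` product_index e"
    then obtain \<beta> \<alpha> where x: "x = \<phi> (monomial \<alpha>) * b \<beta>" "\<beta> \<in> box" by (auto simp: product_index_def)
    have "(\<Sum>\<gamma>\<in>box. \<phi> (if \<gamma> = \<beta> then monomial \<alpha> else 0) * b \<gamma>)
        = (\<Sum>\<gamma>\<in>box. if \<gamma> = \<beta> then \<phi> (monomial \<alpha>) * b \<beta> else 0)"
      by (intro sum.cong) (auto simp: hom_0)
    then show "x \<in> ?C"
      using x by (intro range_eqI[of _ _ "\<lambda>\<gamma>. if \<gamma> = \<beta> then monomial \<alpha> else 0"]) (simp add: finite_box)
  qed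
  then have "kvs.span (?g ` product_index e) \<subseteq> ?C" for e by (rule kvs.span_minimal[OF _ sC])
  then have "forms e \<subseteq> ?C" for e using forms_subset_span_products[OF b] by blast
  then have hC: "degree_part e x \<in> ?C" for e x using homogeneous_degree_part[of e x] by (auto simp: forms_def)
  have spanning: "x \<in> ?C" for x
  proof -
    obtain N where "\<forall>M\<ge>N. (\<Sum>e\<le>M. degree_part e x) = x" using sum_degree_part_ex[of x] ..
    then have "(\<Sum>e\<le>N. degree_part e x) = x" by (elim allE[of _ N] impE) auto
    moreover have "(\<Sum>e\<le>N. degree_part e x) \<in> ?C" by (rule kvs.subspace_sum[OF sC]) (rule hC)
    ultimately show ?thesis by (simp only:)
  qed
  have independent: "s \<beta> = 0" if zero: "(\<Sum>\<beta>\<in>box. \<phi> (s \<beta>) * b \<beta>) = 0" and \<beta>: "\<beta> \<in> box" for s \<beta>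
  proof (rule poly_mapping_eqI)
    fix \<alpha> :: "'v \<Rightarrow>\<^sub>0 nat"
    define e where "e = d * total_degree \<alpha> + total_degree \<beta>"
    let ?c = "\<lambda>(\<beta>, \<alpha>). Poly_Mapping.lookup (s \<beta>) \<alpha>"
    have "degree_part e (\<Sum>\<beta>\<in>box. \<phi> (s \<beta>) * b \<beta>)
        = (\<Sum>\<beta>\<in>box. \<Sum>\<alpha>\<in>{\<alpha>. d * total_degree \<alpha> + total_degree \<beta> = e}. Const (?c (\<beta>, \<alpha>)) * ?g (\<beta>, \<alpha>))"
      unfolding degree_part_sum by (intro sum.cong refl) (simp add: degree_part_product[OF hb])
    also have "\<dots> = (\<Sum>x\<in>product_index e. Const (?c x) * ?g x)"
      unfolding product_index_def
      by (subst sum.Sigma) (auto simp: finite_box finite_cofactors intro!: sum.cong)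
    finally have z: "(\<Sum>x\<in>product_index e. Const (?c x) * ?g x) = 0" by (simp add: zero)
    have "card (product_index e) \<le> kvs.dim (forms e :: ('v, 'k) mpoly set)"
      unfolding dim_forms by (rule card_product_index)
    from kvs.spanning_family_independent[OF finite_product_index forms_subset_span_products[OF b] this z, of "(\<beta>, \<alpha>)"]
    show "Poly_Mapping.lookup (s \<beta>) \<alpha> = Poly_Mapping.lookup 0 \<alpha>"
      using \<beta> by (simp add: product_index_def e_def)
  qed
  have "free_extension \<phi> box b"
  proof unfold_locales
    show "box \<noteq> {}" using zero_in_box by blast
    show "\<exists>s. x = (\<Sum>\<beta>\<in>box. \<phi> (s \<beta>) * b \<beta>)" for x using spanning[of x] by blast
  qed (use finite_box independent in auto)
  then show ?thesis using that by blast
qed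

text \<open>
  The quotient by the \<open>f\<^sub>i\<close> vanishes in degrees beyond those of the monomials in the box.
\<close>

lemma Var_mem_radical_span: "Var i \<in> radical (rmod.span (range f))"
proof -
  obtain b where b: "box_complement b" using box_complement_exists by blast
  let ?N = "card (UNIV :: 'v set) * d"
  have "box \<inter> exponents ?N = {}" by (auto simp: exponents_def dest!: total_degree_box)
  moreover have "(Var i ^ ?N :: ('v, 'k) mpoly) \<in> forms ?N"
  proof -
    have "homogeneous 1 (Var i :: ('v, 'k) mpoly)" using homogeneous_monomial[of "Poly_Mapping.single i 1"] by (simp add: Var_eq_monomial)
    then have "homogeneous n (Var i ^ n :: ('v, 'k) mpoly)" for n
    proof (induction n)
      case 0
      show ?case by (simp add: homogeneous_def)
    next
      case (Suc n)
      then show ?case using homogeneous_mult[of 1 "Var i" n "Var i ^ n"] by simp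
    qed
    then show ?thesis by (simp add: forms_def)
  qed
  ultimately have "Var i ^ ?N \<in> rmod.span (range f)"
    using b unfolding box_complement_def by (fastforce dest: spec[of _ ?N])
  then show ?thesis unfolding radical_def by blast
qed

lemma f_mem_span_Var: "f i \<in> rmod.span (range Var)"
proof -
  have "monomial t \<in> rmod.span (range (Var :: 'v \<Rightarrow> ('v, 'k) mpoly))" if "total_degree t = d" for t
  proof -
    have "t \<noteq> 0" using that d_pos by auto
    then obtain j where j: "Poly_Mapping.lookup t j \<noteq> 0" by (auto simp: poly_mapping_eq_iff fun_eq_iff)
    have "t = (t - Poly_Mapping.single j 1) + Poly_Mapping.single j 1"
      using j by (intro poly_mapping_eqI) (auto simp: lookup_add lookup_minus lookup_single when_def)
    then have "monomial t = monomial (t - Poly_Mapping.single j 1) * (Var j :: ('v, 'k) mpoly)"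
      by (metis monomial_add Var_eq_monomial)
    then show ?thesis by (simp add: rmod.span_scale rmod.span_base)
  qed
  then have "monomial ` exponents d \<subseteq> (rmod.span (range Var) :: ('v, 'k) mpoly set)" by (auto simp: exponents_def)
  then have "kvs.span (monomial ` exponents d) \<subseteq> (rmod.span (range Var) :: ('v, 'k) mpoly set)"
    by (rule kvs.span_minimal[OF _ kvs_subspace_ideal[OF rmod.subspace_span]])
  then show ?thesis using forms_subset_span homog by (auto simp: forms_def)
qed

text \<open>
  The irrelevant ideal and the ideal generated by the \<open>f\<^sub>i\<close> have the same radical.
\<close>

lemma vars_in_radical_iff:
  assumes K: "rmod.subspace K"
  shows "(\<forall>i. Var i \<in> radical K) \<longleftrightarrow> (\<forall>i. f i \<in> radical K)"
proof
  have R: "rmod.subspace (radical K)" by (rule subspace_radical[OF K])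
  show "\<forall>i. f i \<in> radical K" if "\<forall>i. Var i \<in> radical K"
    using rmod.span_minimal[OF _ R, of "range Var"] that f_mem_span_Var by blast
  show "\<forall>i. Var i \<in> radical K" if "\<forall>i. f i \<in> radical K"
  proof
    fix i
    have "rmod.span (range f) \<subseteq> radical K" using rmod.span_minimal[OF _ R, of "range f"] that by blast
    moreover obtain n where "Var i ^ n \<in> rmod.span (range f)"
      using Var_mem_radical_span[of i] by (auto simp: radical_def)
    ultimately have "Var i ^ n \<in> radical K" by blast
    then show "Var i \<in> radical K" by (rule radical_idem)
  qed
qed

lemma graded_ext:
  assumes J: "graded J"
  shows "graded (extended_ideal J)"
  unfolding extended_ideal_def
proof (rule graded_span)
  fix g e assume "g \<in> \<phi> ` J"
  then obtain p where p: "p \<in> J" "g = \<phi> p" by blast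
  then have "degree_part (e div d) p \<in> J" using J by (simp add: graded_def)
  then show "degree_part e g \<in> rmod.span (\<phi> ` J)"
    by (simp add: p(2) degree_part_hom rmod.span_zero rmod.span_base)
qed

lemma graded_vimage:
  assumes "graded Q" shows "graded (\<phi> -` Q)"
  unfolding graded_def
proof (intro ballI allI)
  fix p e assume "p \<in> \<phi> -` Q"
  then have "degree_part (d * e) (\<phi> p) \<in> Q" using assms by (simp add: graded_def)
  then show "degree_part e p \<in> \<phi> -` Q" using d_pos by (simp add: degree_part_hom)
qed

text \<open>
  Comparable points of \<open>V(\<phi>\<^sub>*(J))\<close> contract to comparable points of \<open>V(J)\<close>, which coincide, so
  incomparability applies. The contraction misses a variable because \<open>Q\<close> misses one and the \<open>f\<^sub>i\<close>
  generate the irrelevant ideal up to radical.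
\<close>

lemma zero_dimensional_ext:
  assumes dim: "zero_dimensional J"
  shows "zero_dimensional (extended_ideal J)"
  unfolding zero_dimensional_def
proof (intro allI impI)
  fix P Q :: "('v, 'k) mpoly set"
  assume *: "is_prime_ideal P \<and> graded P \<and> is_prime_ideal Q \<and> graded Q \<and>
     extended_ideal J \<subseteq> P \<and> P \<subseteq> Q \<and> (\<exists>i. Var i \<notin> Q)"
  then have SP: "rmod.subspace P" and SQ: "rmod.subspace Q" by (auto simp: is_prime_ideal_iff)
  obtain b where "free_extension \<phi> box b" by (rule free_over_image)
  then interpret free_extension \<phi> box b .
  have radQ: "radical Q = Q" using * radical_subset_prime[of Q Q] subset_radical[of Q] by blast
  have "\<not> (\<forall>i. Var i \<in> Q)" using * by blast
  then have "\<not> (\<forall>i. f i \<in> Q)" using vars_in_radical_iff[OF SQ] unfolding radQ by blast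
  then have "\<exists>i. Var i \<notin> \<phi> -` Q" by (simp add: hom_Var)
  moreover have "J \<subseteq> \<phi> -` P" using * ext_subset_iff[OF SP] by simp
  moreover have "\<phi> -` P \<subseteq> \<phi> -` Q" using * by blast
  ultimately have contr: "\<phi> -` P = \<phi> -` Q"
    using dim * prime_vimage graded_vimage unfolding zero_dimensional_def by simp
  have "is_prime_ideal P" "is_prime_ideal Q" "P \<subseteq> Q" using * by simp_all
  from prime_incomparable[OF this contr] show "P = Q" .
qed

text \<open>
  Since each \<open>f\<^sub>i\<close> has positive degree, it also multiplies \<open>x\<close> into \<open>\<phi>\<^sub>*(J)\<close>; in coordinates this says that
  every variable multiplies the coordinates of \<open>x\<close> into \<open>J\<close>.
\<close>

lemma socle_free_ext:
  assumes J: "rmod.subspace J" and sat: "\<And>x. (\<And>i. Var i * x \<in> J) \<Longrightarrow> x \<in> J"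
    and x: "\<And>i. Var i * x \<in> extended_ideal J"
  shows "x \<in> extended_ideal J"
proof -
  obtain b where "free_extension \<phi> box b" by (rule free_over_image)
  then interpret free_extension \<phi> box b .
  obtain s where s: "x = combine s" by (rule combine_surj)
  have "rmod.span (range Var) \<subseteq> colon (extended_ideal J) x"
    using x by (intro rmod.span_minimal subspace_colon subspace_ext) (auto simp: colon_def)
  then have "f i \<in> colon (extended_ideal J) x" for i using f_mem_span_Var by blast
  then have "\<phi> (Var i) * combine s \<in> extended_ideal J" for i by (simp add: colon_def hom_Var s)
  then have "Var i * s \<beta> \<in> J" if "\<beta> \<in> box" for i \<beta>
    using that by (simp add: combine_scale combine_mem_ext_iff[OF J])
  then have "\<forall>\<beta>\<in>box. s \<beta> \<in> J" using sat by blast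
  then show ?thesis by (simp add: s combine_mem_ext_iff[OF J])
qed

text \<open>
  Powers of the variables may be replaced by powers of the \<open>f\<^sub>i\<close>, which are images of powers of
  variables and hence act on coordinates. Finiteness of the basis allows a common exponent.
\<close>

lemma torsion_saturation_ext:
  assumes L: "rmod.subspace L"
  shows "torsion_saturation (extended_ideal L) = extended_ideal (torsion_saturation L)"
proof -
  obtain b where "free_extension \<phi> box b" by (rule free_over_image)
  then interpret free_extension \<phi> box b .
  have "combine s \<in> torsion_saturation (extended_ideal L) \<longleftrightarrow> combine s \<in> extended_ideal (torsion_saturation L)" for s
  proof -
    have colon_iff: "f i ^ n \<in> colon (extended_ideal L) (combine s) \<longleftrightarrow> (\<forall>\<beta>\<in>box. Var i ^ n * s \<beta> \<in> L)" for i n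
    proof -
      have "f i ^ n * combine s = combine (\<lambda>\<beta>. Var i ^ n * s \<beta>)"
        unfolding combine_scale[symmetric] by (simp add: hom_power hom_Var)
      then show ?thesis by (simp add: colon_def combine_mem_ext_iff[OF L])
    qed
    have "combine s \<in> torsion_saturation (extended_ideal L) \<longleftrightarrow> (\<forall>i. f i \<in> radical (colon (extended_ideal L) (combine s)))"
      unfolding torsion_saturation_def
      using vars_in_radical_iff[OF subspace_colon[OF subspace_ext]] by simp
    also have "\<dots> \<longleftrightarrow> (\<forall>i. \<exists>n. \<forall>\<beta>\<in>box. Var i ^ n * s \<beta> \<in> L)"
      by (simp add: radical_def colon_iff)
    also have "\<dots> \<longleftrightarrow> (\<forall>i. \<forall>\<beta>\<in>box. \<exists>n. Var i ^ n * s \<beta> \<in> L)"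
    proof (intro iffI allI)
      fix i assume "\<forall>i. \<forall>\<beta>\<in>box. \<exists>n. Var i ^ n * s \<beta> \<in> L"
      then obtain n where n: "\<And>\<beta>. \<beta> \<in> box \<Longrightarrow> Var i ^ n \<beta> * s \<beta> \<in> L" by metis
      have "Var i ^ (sum n box) * s \<beta> \<in> L" if "\<beta> \<in> box" for \<beta>
      proof -
        have "sum n box = sum n (box - {\<beta>}) + n \<beta>"
          using sum.remove[OF finite_box that, of n] by simp
        then have "Var i ^ (sum n box) * s \<beta> = Var i ^ sum n (box - {\<beta>}) * (Var i ^ n \<beta> * s \<beta>)"
          by (simp only: power_add mult.assoc)
        then show ?thesis using rmod.subspace_scale[OF L n[OF that]] by (simp only:)
      qed
      then show "\<exists>n. \<forall>\<beta>\<in>box. Var i ^ n * s \<beta> \<in> L" by blast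
    qed blast
    also have "\<dots> \<longleftrightarrow> (\<forall>\<beta>\<in>box. s \<beta> \<in> torsion_saturation L)"
      by (auto simp: torsion_saturation_def radical_def colon_def)
    also have "\<dots> \<longleftrightarrow> combine s \<in> extended_ideal (torsion_saturation L)"
      by (rule combine_mem_ext_iff[OF subspace_torsion_saturation[OF L], symmetric])
    finally show ?thesis .
  qed
  then show ?thesis using combine_surj by (metis (no_types, lifting) subsetI subset_antisym)
qed

text \<open>
  The extension \<open>\<phi>\<^sub>*\<close> commutes with powers and with the saturations that compute symbolic powers, and it
  reflects containments.
\<close>

theorem symbolic_containment_iff:
  assumes J: "rmod.subspace J" "graded J" and dim: "zero_dimensional J"
    and sat: "\<And>x. (\<And>i. Var i * x \<in> J) \<Longrightarrow> x \<in> J"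
  shows "symbolic_power (extended_ideal J) m \<subseteq> ideal_power (extended_ideal J) r \<longleftrightarrow> symbolic_power J m \<subseteq> ideal_power J r"
proof -
  obtain b where "free_extension \<phi> box b" by (rule free_over_image)
  then interpret free_extension \<phi> box b .
  have eq: "symbolic_power J m = torsion_saturation (ideal_power J m)"
    by (rule symbolic_power_eq_saturation[OF J dim]) (rule sat)
  have Jm: "rmod.subspace (ideal_power J n)" for n by (rule subspace_ideal_power[OF J(1)])
  have "symbolic_power (extended_ideal J) m = torsion_saturation (ideal_power (extended_ideal J) m)"
    using socle_free_ext[OF J(1) sat]
    by (intro symbolic_power_eq_saturation subspace_ext graded_ext J zero_dimensional_ext dim) blast
  also have "\<dots> = extended_ideal (torsion_saturation (ideal_power J m))"
    by (simp add: ext_ideal_power[OF J(1)] torsion_saturation_ext[OF Jm])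
  also have "\<dots> = extended_ideal (symbolic_power J m)" by (simp only: eq)
  finally have "symbolic_power (extended_ideal J) m = extended_ideal (symbolic_power J m)" .
  moreover have "rmod.subspace (symbolic_power J m)"
    unfolding eq by (rule subspace_torsion_saturation[OF Jm])
  ultimately show ?thesis
    by (simp add: ext_ideal_power[OF J(1)] ext_subset_ext_iff[OF _ Jm])
qed

end

theorem theorem4:
  fixes f :: "'v::{finite,linorder} \<Rightarrow> ('v, 'k::field) mpoly"
    and \<phi> :: "('v, 'k) mpoly \<Rightarrow> ('v, 'k) mpoly"
    and I :: "('v, 'k) mpoly set"
    and d m r :: nat
  assumes "regular_sequence f"
    and "\<And>i. homogeneous d (f i)"
    and "algebra_hom \<phi>"
    and "\<And>i. \<phi> (Var i) = f i"
    and "is_ideal I"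
    and "homogeneous_ideal I"
    and "saturated I"
    and "krull_dim (vanishing_space I) = 0"
    and "m > 0"
    and "r > 0"
  shows "symbolic_power I m \<subseteq> ideal_power I r \<longleftrightarrow>
    symbolic_power (ideal_gen (\<phi> ` I)) m \<subseteq> ideal_power (ideal_gen (\<phi> ` I)) r"
proof -
  interpret regular_substitution f d \<phi>
    using assms(1-4)
    by unfold_locales (auto simp: algebra_hom_def ring_hom_def class_simps)
  have I: "rmod.subspace I" using assms(5) by (simp add: is_ideal_iff)
  (* The first power of the irrelevant ideal already witnesses membership in the saturation. *)
  have "x \<in> I" if x: "\<And>i. Var i * x \<in> I" for x
  proof -
    have irr: "rmod.subspace (irrelevant_ideal :: ('v, 'k) mpoly set)"
      by (simp add: irrelevant_ideal_def ideal_gen_eq_span)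
    have "irrelevant_ideal \<subseteq> colon I x"
      unfolding irrelevant_ideal_subset_iff[OF subspace_colon[OF I]] using x by (simp add: colon_def)
    then have "\<forall>q\<in>ideal_power irrelevant_ideal (Suc 0). x * q \<in> I"
      unfolding ideal_power_one[OF irr] by (auto simp: colon_def mult.commute)
    then have "x \<in> ideal_saturation I irrelevant_ideal"
      unfolding ideal_saturation_def by blast
    then show ?thesis using assms(7) by (simp add: saturated_def)
  qed
  then show ?thesis
    using symbolic_containment_iff[OF I homogeneous_ideal_iff[OF I, THEN iffD1, OF assms(6)]
        zero_dimensional_if_krull_dim[OF assms(8)], of m r]
    by (simp add: extended_ideal_def ideal_gen_eq_span)
qed

end
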